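(* Let $0<p<1$ and $r,k,m\in\mathbb{N}$. There is a constant $C$, independent of $f$ and $\delta$, such that for every function $f$ on $[0,1]$ with $f^{(r-1)}\in AC[0,1]$ and every $\delta>0$, $$\omega_{r+k}(f,\delta)_p\le C\delta^r\omega_k(f^{(r)},\delta)_p+C\delta^{r+\frac1p-1}\left(\int_0^\delta\frac{\omega_m(f^{(r)},t)_p^p}{t^{2-p}}\,dt\right)^{\frac1p}.$$
   Context: $AC[0,1]$ is the set of absolutely continuous functions on $[0,1]$; when $f^{(r-1)}\in AC[0,1]$, $f^{(r)}$ denotes the (a.e. defined, integrable) derivative of $f^{(r-1)}$. For $s\in\mathbb{N}$ the (non-periodic) modulus of smoothness of order $s$ in $L_p[0,1]$ is $\omega_s(f,\delta)_p=\sup_{0<h\le\delta}\|\Delta_h^sf\|_{L_p[0,1-sh]}$, where $\Delta_h^sf(x)=\sum_{\nu=0}^s\binom{s}{\nu}(-1)^\nu f(x+\nu h)$, $\|g\|_{L_p[a,b]}=\left(\int_a^b|g(x)|^p\,dx\right)^{1/p}$, and the norm over an empty interval (when $sh>1$) is $0$. The right-hand side is allowed to be $+\infty$, in which case the inequality is trivial. *)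

theory Defs
  imports "HOL-Analysis.Analysis"
begin

(* For x = 0 and a < 0 the value is 0, not infinity; only exponents a > 0 are used. *)
definition ennpowr :: "ennreal \<Rightarrow> real \<Rightarrow> ennreal" (infixr \<open>ennpowr\<close> 80) where
  "x ennpowr a = (if x = \<infinity> then \<infinity> else ennreal (enn2real x powr a))"

(* The epsilon-delta definition over finite families of non-overlapping compact intervals
   [Inf K, Sup K] inside S; meant for S an interval. *)
definition absolutely_continuous_on :: "real set \<Rightarrow> (real \<Rightarrow> real) \<Rightarrow> bool" where
  "absolutely_continuous_on S f \<longleftrightarrow>
     (\<forall>e>0. \<exists>d>0. \<forall>D T. D division_of T \<and> T \<subseteq> S \<and> (\<Sum>K\<in>D. Sup K - Inf K) < d
        \<longrightarrow> (\<Sum>K\<in>D. \<bar>f (Sup K) - f (Inf K)\<bar>) < e)"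

(* Derivatives are taken within S, hence one-sided at the endpoints when S = [0,1]. At points of
   non-differentiability the value is an unspecified constant; for the top derivative in the
   situation described by deriv_AC these points form a null set, which the integrals below
   do not see. *)
primrec nth_deriv_within :: "real set \<Rightarrow> nat \<Rightarrow> (real \<Rightarrow> real) \<Rightarrow> real \<Rightarrow> real" where
  "nth_deriv_within S 0 f = f"
| "nth_deriv_within S (Suc n) f =
     (\<lambda>x. vector_derivative (nth_deriv_within S n f) (at x within S))"

(* The n-th derivative exists everywhere on [0,1] and belongs to AC[0,1]. *)
definition deriv_AC :: "nat \<Rightarrow> (real \<Rightarrow> real) \<Rightarrow> bool" where
  "deriv_AC n f \<longleftrightarrow>
     (\<forall>j<n. \<forall>x\<in>{0..1}. nth_deriv_within {0..1} j f differentiable (at x within {0..1})) \<and>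
     absolutely_continuous_on {0..1} (nth_deriv_within {0..1} n f)"

(* Vanishes for a > b, the interval then being empty. *)
definition Lp_norm_on :: "real \<Rightarrow> real \<Rightarrow> real \<Rightarrow> (real \<Rightarrow> real) \<Rightarrow> ennreal" where
  "Lp_norm_on p a b g = (\<integral>\<^sup>+x\<in>{a..b}. ennreal (\<bar>g x\<bar> powr p) \<partial>lebesgue) ennpowr (1 / p)"

definition finite_difference :: "nat \<Rightarrow> real \<Rightarrow> (real \<Rightarrow> real) \<Rightarrow> real \<Rightarrow> real" where
  "finite_difference s h f x = (\<Sum>\<nu>\<le>s. real (s choose \<nu>) * (- 1) ^ \<nu> * f (x + real \<nu> * h))"

definition modulus_of_smoothness :: "nat \<Rightarrow> (real \<Rightarrow> real) \<Rightarrow> real \<Rightarrow> real \<Rightarrow> ennreal" where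
  "modulus_of_smoothness s f \<delta> p =
     (SUP h\<in>{0<..\<delta>}. Lp_norm_on p 0 (1 - real s * h) (finite_difference s h f))"

end

theory Submission
  imports Defs
begin

text \<open>
  Write \<open>g\<close> for the derivative of order \<open>r\<close> of \<open>f\<close>, and \<open>G = \<Delta>\<^sub>h\<^sup>k g\<close>. Since the derivative of order
  \<open>r - 1\<close> is an indefinite integral of \<open>g\<close>, each of \<open>r\<close> integrations turns one difference of order one
  into an integral over an interval of length \<open>h\<close>, so that \<open>\<bar>\<Delta>\<^sub>h\<^sup>r\<^sup>+\<^sup>k f(x)\<bar>\<close> is at most \<open>h\<^sup>r\<^sup>-\<^sup>1\<close> times the
  integral of \<open>\<bar>G\<bar>\<close> over \<open>[x, x + r h]\<close>. For \<open>p \<ge> 1\<close> the Minkowski inequality would finish the proof;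
  for \<open>p < 1\<close> an \<open>L\<^sub>1\<close> norm over a window cannot be bounded by an \<open>L\<^sub>p\<close> norm alone, and the second
  term of the theorem pays for the difference.

  The main point is therefore a local inequality. Let \<open>A\<close> be the integral of \<open>\<bar>G\<bar>\<close> over an interval \<open>I\<close>, let
  \<open>T\<close> be a small multiple of the length of \<open>I\<close>, and let \<open>\<Phi>(y)\<close> be the integral of
  \<open>\<bar>\<Delta>\<^sub>t\<^sup>m G(y)\<bar> powr p * t powr (p - 2)\<close> over \<open>0 < t < T\<close>, with differences taken forwards or backwards so as
  to stay inside \<open>I\<close>. Then \<open>A powr p\<close> is at most a constant times the integral over \<open>I\<close> of
  \<open>T powr (p - 1) * \<bar>G\<bar> powr p + \<Phi>\<close>.

  To see this, note that in the expansion of \<open>\<Delta>\<^sub>t\<^sup>m G(y)\<close> the terms other than \<open>G(y)\<close> have an average at most of order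
  \<open>A / \<epsilon>\<close> over \<open>0 < t < \<epsilon>\<close>. If \<open>\<epsilon>\<close> is a large multiple of \<open>A / \<bar>G(y)\<bar>\<close>, they are below \<open>\<bar>G(y)\<bar> / 2\<close> for most
  such \<open>t\<close>, and there \<open>\<bar>\<Delta>\<^sub>t\<^sup>m G(y)\<bar> \<ge> \<bar>G(y)\<bar> / 2\<close>. Integrating against the weight \<open>t powr (p - 2)\<close>, which is
  the one that makes the powers of \<open>\<bar>G(y)\<bar>\<close> cancel, gives \<open>\<bar>G(y)\<bar> \<le> c * A powr (1 - p) * \<Phi>(y)\<close>. This requires
  \<open>\<epsilon> \<le> T\<close>; otherwise \<open>\<bar>G(y)\<bar> \<le> c * A / T\<close>, hence \<open>\<bar>G(y)\<bar> \<le> (c * A / T) powr (1 - p) * \<bar>G(y)\<bar> powr p\<close>.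
  Integrating over \<open>y\<close> and dividing by \<open>A powr (1 - p)\<close>, which is possible since \<open>A\<close> is finite, yields
  the inequality (\<open>recover_from_small_steps\<close>, \<open>L1_le_Lp_and_energy\<close>).

  Applied to \<open>I = [x, x + r h]\<close> and integrated over \<open>x\<close>, it produces both terms of the theorem, because
  \<open>\<Delta>\<^sub>t\<^sup>m\<close> commutes with \<open>\<Delta>\<^sub>h\<^sup>k\<close> and the \<open>p\<close>-th power of the absolute value is subadditive
  (\<open>nn_integral_difference_energy_le\<close>, \<open>Lp_power_difference_le\<close>).

  That an absolutely continuous function is the indefinite integral of its almost everywhere derivative
  follows from the Radon--Nikodym theorem and the differentiability almost everywhere of indefinite
  integrals (\<open>absolutely_continuous_imp_indefinite_integral\<close>).
\<close>

section \<open>Absolutely continuous functions as indefinite integrals\<close>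

text \<open>Divisions are sets of intervals, which cannot list an interval twice. In applications the intervals
  come as indexed families, possibly with degenerate or repeated members; the degenerate ones contribute nothing
  and the others are pairwise different because their interiors are disjoint.\<close>
lemma absolutely_continuous_onD_indexed:
  fixes F :: "real \<Rightarrow> real"
  assumes "absolutely_continuous_on S F" "e > 0"
  obtains d where "d > 0"
    "\<And>(I :: 'i set) a b. \<lbrakk>finite I; \<And>i. i \<in> I \<Longrightarrow> a i \<le> b i \<and> {a i..b i} \<subseteq> S;
        pairwise (\<lambda>i j. {a i<..<b i} \<inter> {a j<..<b j} = {}) I; (\<Sum>i\<in>I. b i - a i) < d\<rbrakk>
      \<Longrightarrow> (\<Sum>i\<in>I. \<bar>F (b i) - F (a i)\<bar>) < e"
proof -
  obtain d where d: "d > 0" and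
    D: "\<And>D T. \<lbrakk>D division_of T; T \<subseteq> S; (\<Sum>K\<in>D. Sup K - Inf K) < d\<rbrakk>
        \<Longrightarrow> (\<Sum>K\<in>D. \<bar>F (Sup K) - F (Inf K)\<bar>) < e"
    using assms unfolding absolutely_continuous_on_def by meson
  show ?thesis
  proof (rule that[OF d])
    fix I :: "'i set" and a b
    assume fin: "finite I" and ab: "\<And>i. i \<in> I \<Longrightarrow> a i \<le> b i \<and> {a i..b i} \<subseteq> S"
      and disj: "pairwise (\<lambda>i j. {a i<..<b i} \<inter> {a j<..<b j} = {}) I"
      and len: "(\<Sum>i\<in>I. b i - a i) < d"
    define J where "J = {i\<in>I. a i < b i}"
    define K where "K i = {a i..b i}" for i
    have disjJ: "{a i<..<b i} \<inter> {a j<..<b j} = {}" if "i \<in> J" "j \<in> J" "i \<noteq> j" for i j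
      using disj that by (auto simp: J_def pairwise_def)
    have inj: "inj_on K J"
    proof (rule inj_onI, rule ccontr)
      fix i j assume ij: "i \<in> J" "j \<in> J" "K i = K j" "i \<noteq> j"
      then have "a i = a j" "b i = b j" by (auto simp: K_def J_def)
      then have "{a i<..<b i} = {}" using disjJ[OF ij(1,2,4)] by auto
      then show False using ij(1) by (auto simp: J_def)
    qed
    have "K ` J division_of \<Union> (K ` J)"
    proof (rule division_ofI)
      show "finite (K ` J)" using fin by (simp add: J_def)
      show "X \<subseteq> \<Union> (K ` J)" if "X \<in> K ` J" for X using that by auto
      show "X \<noteq> {}" if "X \<in> K ` J" for X using that by (auto simp: K_def J_def)
      show "\<exists>a b. X = cbox a b" if "X \<in> K ` J" for X using that by (auto simp: K_def)
      show "interior X \<inter> interior Y = {}" if XY: "X \<in> K ` J" "Y \<in> K ` J" "X \<noteq> Y" for X Y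
      proof -
        obtain i j where ij: "i \<in> J" "j \<in> J" "X = K i" "Y = K j" "i \<noteq> j" using XY by blast
        then show ?thesis using disjJ[of i j] by (simp add: K_def)
      qed
    qed simp
    moreover have "\<Union> (K ` J) \<subseteq> S" using ab by (auto simp: K_def J_def)
    moreover have "(\<Sum>X\<in>K ` J. Sup X - Inf X) = (\<Sum>i\<in>I. b i - a i)"
    proof -
      have "(\<Sum>X\<in>K ` J. Sup X - Inf X) = (\<Sum>i\<in>J. b i - a i)"
        by (subst sum.reindex[OF inj]) (auto simp: K_def J_def intro!: sum.cong)
      also have "\<dots> = (\<Sum>i\<in>I. b i - a i)"
        using fin ab by (intro sum.mono_neutral_left) (force simp: J_def)+
      finally show ?thesis .
    qed
    ultimately have "(\<Sum>X\<in>K ` J. \<bar>F (Sup X) - F (Inf X)\<bar>) < e" using D len by simp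
    also have "(\<Sum>X\<in>K ` J. \<bar>F (Sup X) - F (Inf X)\<bar>) = (\<Sum>i\<in>J. \<bar>F (b i) - F (a i)\<bar>)"
      by (subst sum.reindex[OF inj]) (auto simp: K_def J_def intro!: sum.cong)
    also have "\<dots> = (\<Sum>i\<in>I. \<bar>F (b i) - F (a i)\<bar>)"
      using fin ab by (intro sum.mono_neutral_left) (force simp: J_def)+
    finally show "(\<Sum>i\<in>I. \<bar>F (b i) - F (a i)\<bar>) < e" .
  qed
qed

lemma absolutely_continuous_on_imp_continuous_on:
  assumes F: "absolutely_continuous_on {0..1} F"
  shows "continuous_on {0..1} F"
  unfolding continuous_on_iff
proof (intro ballI allI impI)
  fix x e :: real assume x: "x \<in> {0..1}" and e: "0 < e"
  obtain d where d: "d > 0" "\<And>(I :: unit set) a b. \<lbrakk>finite I; \<And>i. i \<in> I \<Longrightarrow> a i \<le> b i \<and> {a i..b i} \<subseteq> {0..1};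
        pairwise (\<lambda>i j. {a i<..<b i} \<inter> {a j<..<b j} = {}) I; (\<Sum>i\<in>I. b i - a i) < d\<rbrakk>
      \<Longrightarrow> (\<Sum>i\<in>I. \<bar>F (b i) - F (a i)\<bar>) < e"
    by (rule absolutely_continuous_onD_indexed[OF F e, where 'i = unit]) blast
  have "dist (F y) (F x) < e" if y: "y \<in> {0..1}" "dist y x < d" for y
  proof -
    have "(\<Sum>i\<in>{()}. \<bar>F (max x y) - F (min x y)\<bar>) < e"
      using x y by (intro d(2)) (auto simp: dist_real_def min_def max_def pairwise_def)
    then show ?thesis by (auto simp: dist_real_def min_def max_def abs_minus_commute split: if_splits)
  qed
  then show "\<exists>d>0. \<forall>y\<in>{0..1}. dist y x < d \<longrightarrow> dist (F y) (F x) < e" using d(1) by blast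
qed

definition clip :: "real \<Rightarrow> real \<Rightarrow> real \<Rightarrow> real" where
  "clip a b t = max a (min b t)"

text \<open>A fixed dyadic grid of \<open>[0,1]\<close>, clipped to \<open>[a,b]\<close>, replaces the arbitrary partitions of \<open>[a,b]\<close>: the sums then
  increase with \<open>n\<close>, and the sums for different intervals can be compared term by term.\<close>
definition dyadic_variation :: "nat \<Rightarrow> (real \<Rightarrow> real) \<Rightarrow> real \<Rightarrow> real \<Rightarrow> real" where
  "dyadic_variation n F a b =
     (\<Sum>i<2^n. \<bar>F (clip a b (real (Suc i) / 2^n)) - F (clip a b (real i / 2^n))\<bar>)"

lemma clip_mono: "s \<le> t \<Longrightarrow> clip a b s \<le> clip a b t"
  by (auto simp: clip_def)

lemma clip_ge: "a \<le> clip a b t"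
  by (auto simp: clip_def)

lemma clip_le: "a \<le> b \<Longrightarrow> clip a b t \<le> b"
  by (auto simp: clip_def)

lemma dyadic_variation_Suc_ge: "dyadic_variation n F a b \<le> dyadic_variation (Suc n) F a b"
proof -
  define u where "u j = F (clip a b (real j / 2^Suc n))" for j
  have u2: "F (clip a b (real i / 2^n)) = u (2 * i)" for i
    by (simp add: u_def)
  have "dyadic_variation n F a b = (\<Sum>i<2^n. \<bar>u (2 * Suc i) - u (2 * i)\<bar>)"
    unfolding dyadic_variation_def u2 ..
  also have "\<dots> \<le> (\<Sum>i<2^n. \<bar>u (Suc (2 * i)) - u (2 * i)\<bar> + \<bar>u (Suc (Suc (2 * i))) - u (Suc (2 * i))\<bar>)"
    by (intro sum_mono) simp
  also have "\<dots> = (\<Sum>j<2 * N. \<bar>u (Suc j) - u j\<bar>)" if "N = 2^n" for N :: nat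
    unfolding that[symmetric] by (induction N) (auto simp: algebra_simps)
  finally show ?thesis by (simp add: dyadic_variation_def u_def)
qed

lemma dyadic_variation_incseq: "incseq (\<lambda>n. dyadic_variation n F a b)"
  by (intro incseq_SucI dyadic_variation_Suc_ge)

lemma dyadic_variation_diff_le:
  assumes "0 \<le> x" "x \<le> y"
  shows "dyadic_variation n F 0 y - dyadic_variation n F 0 x \<le> dyadic_variation n F x y"
proof -
  have *: "\<bar>F (clip 0 y t) - F (clip 0 y s)\<bar> - \<bar>F (clip 0 x t) - F (clip 0 x s)\<bar>
      \<le> \<bar>F (clip x y t) - F (clip x y s)\<bar>" if "s \<le> t" for s t
    using that assms by (auto simp: clip_def min_def max_def)
  show ?thesis
    unfolding dyadic_variation_def sum_subtractf[symmetric]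
    by (intro sum_mono *) (simp add: divide_right_mono)
qed

text \<open>Only the grid cell that contains \<open>x\<close> in its interior is shared by the sums for \<open>[0,x]\<close> and \<open>[x,y]\<close>.
  Splitting that cell at \<open>x\<close> costs at most twice the increment of \<open>F\<close> from its left end to \<open>x\<close>,
  which vanishes in the limit for continuous \<open>F\<close>.\<close>
lemma dyadic_variation_diff_ge:
  assumes x: "0 \<le> x" "x \<le> y" "y \<le> 1"
  shows "\<bar>F y - F x\<bar> - 2 * \<bar>F x - F (real (nat \<lfloor>x * 2^n\<rfloor>) / 2^n)\<bar>
      \<le> dyadic_variation n F 0 y - dyadic_variation n F 0 x"
proof -
  define j where "j = nat \<lfloor>x * 2^n\<rfloor>"
  define c where "c = 2 * \<bar>F x - F (real j / 2^n)\<bar>"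
  have *: "\<bar>F (clip x y (real (Suc i) / 2^n)) - F (clip x y (real i / 2^n))\<bar> \<le>
      \<bar>F (clip 0 y (real (Suc i) / 2^n)) - F (clip 0 y (real i / 2^n))\<bar>
      - \<bar>F (clip 0 x (real (Suc i) / 2^n)) - F (clip 0 x (real i / 2^n))\<bar>
      + (if i = j then c else 0)" (is "?L i \<le> ?R i") for i
  proof -
    consider "real (Suc i) / 2^n \<le> x" | "x \<le> real i / 2^n" | "real i / 2^n < x" "x < real (Suc i) / 2^n"
      by linarith
    then show ?thesis
    proof cases
      case 1
      have "real i / 2^n \<le> real (Suc i) / 2^n" by (simp add: divide_right_mono)
      then have "?L i = 0" using 1 x by (auto simp: clip_def)
      moreover have "clip 0 y (real (Suc i) / 2^n) = clip 0 x (real (Suc i) / 2^n)"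
        "clip 0 y (real i / 2^n) = clip 0 x (real i / 2^n)"
        using 1 x \<open>real i / 2^n \<le> real (Suc i) / 2^n\<close> by (auto simp: clip_def)
      ultimately show ?thesis by (simp add: c_def)
    next
      case 2
      have "real i / 2^n \<le> real (Suc i) / 2^n" by (simp add: divide_right_mono)
      then have "clip 0 y (real (Suc i) / 2^n) = clip x y (real (Suc i) / 2^n)"
        "clip 0 y (real i / 2^n) = clip x y (real i / 2^n)"
        "clip 0 x (real (Suc i) / 2^n) = x" "clip 0 x (real i / 2^n) = x"
        using 2 x by (auto simp: clip_def)
      then show ?thesis by (simp add: c_def)
    next
      case 3
      have "real i \<le> x * 2^n" "x * 2^n < real i + 1"
        using 3 by (auto simp: field_simps)
      then have "\<lfloor>x * 2^n\<rfloor> = int i" by (intro floor_unique) auto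
      then have ij: "i = j" by (simp add: j_def)
      have "clip 0 y (real i / 2^n) = real i / 2^n" "clip 0 x (real i / 2^n) = real i / 2^n"
        "clip x y (real i / 2^n) = x" "clip 0 x (real (Suc i) / 2^n) = x"
        "clip 0 y (real (Suc i) / 2^n) = clip x y (real (Suc i) / 2^n)"
        using 3 x by (auto simp: clip_def)
      then show ?thesis using ij by (simp add: c_def)
    qed
  qed
  have "\<bar>F y - F x\<bar> = \<bar>\<Sum>i<2^n. F (clip x y (real (Suc i) / 2^n)) - F (clip x y (real i / 2^n))\<bar>"
  proof -
    have "clip x y 1 = y" "clip x y 0 = x" using x by (auto simp: clip_def)
    then show ?thesis
      by (subst sum_lessThan_telescope) simp
  qed
  also have "\<dots> \<le> (\<Sum>i<2^n. ?L i)" by (rule sum_abs)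
  also have "\<dots> \<le> (\<Sum>i<2^n. ?R i)" by (intro sum_mono *)
  also have "\<dots> = dyadic_variation n F 0 y - dyadic_variation n F 0 x + (\<Sum>i<2^n. if i = j then c else 0)"
    by (simp add: dyadic_variation_def sum.distrib sum_subtractf)
  also have "(\<Sum>i<2^n. if i = j then c else 0) \<le> c"
    by (simp add: c_def)
  finally show ?thesis by (simp add: c_def j_def)
qed

text \<open>A bound that is uniform in \<open>n\<close>: the clipped grid cells of all the intervals together form one family with
  the same total length, to which absolute continuity applies.\<close>
lemma dyadic_variation_sum_small:
  assumes F: "absolutely_continuous_on {0..1} F" and e: "e > 0"
  obtains d where "d > 0"
    "\<And>(I :: 'i set) a b n. \<lbrakk>finite I; \<And>i. i \<in> I \<Longrightarrow> a i \<le> b i \<and> {a i..b i} \<subseteq> {0..1};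
        pairwise (\<lambda>i j. {a i<..<b i} \<inter> {a j<..<b j} = {}) I; (\<Sum>i\<in>I. b i - a i) < d\<rbrakk>
      \<Longrightarrow> (\<Sum>i\<in>I. dyadic_variation n F (a i) (b i)) < e"
proof -
  obtain d where d: "d > 0" and
    D: "\<And>(I :: ('i \<times> nat) set) a b. \<lbrakk>finite I; \<And>i. i \<in> I \<Longrightarrow> a i \<le> b i \<and> {a i..b i} \<subseteq> {0..1};
        pairwise (\<lambda>i j. {a i<..<b i} \<inter> {a j<..<b j} = {}) I; (\<Sum>i\<in>I. b i - a i) < d\<rbrakk>
      \<Longrightarrow> (\<Sum>i\<in>I. \<bar>F (b i) - F (a i)\<bar>) < e"
    by (rule absolutely_continuous_onD_indexed[OF F e, where 'i = "'i \<times> nat"]) blast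
  show ?thesis
  proof (rule that[OF d])
    fix I :: "'i set" and a b n
    assume fin: "finite I" and ab: "\<And>i. i \<in> I \<Longrightarrow> a i \<le> b i \<and> {a i..b i} \<subseteq> {0..1}"
      and disj: "pairwise (\<lambda>i j. {a i<..<b i} \<inter> {a j<..<b j} = {}) I"
      and len: "(\<Sum>i\<in>I. b i - a i) < d"
    define u where "u = (\<lambda>(i, k). clip (a i) (b i) (real k / 2^n))"
    define v where "v = (\<lambda>(i, k). clip (a i) (b i) (real (Suc k) / 2^n))"
    have uv: "a i \<le> u (i, k)" "u (i, k) \<le> v (i, k)" "v (i, k) \<le> b i" if "i \<in> I" for i k
      using ab[OF that] by (auto simp: u_def v_def clip_ge clip_le divide_right_mono intro!: clip_mono)
    have tele: "(\<Sum>k<2^n. v (i, k) - u (i, k)) = b i - a i" if "i \<in> I" for i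
    proof -
      have 1: "clip (a i) (b i) 1 = b i" "clip (a i) (b i) 0 = a i"
        using ab[OF that] by (auto simp: clip_def)
      show ?thesis unfolding u_def v_def prod.case by (subst sum_lessThan_telescope) (simp add: 1)
    qed
    have mono_uv: "v (i, k) \<le> u (i, l)" if "k < l" for i k l
      using that by (auto simp: u_def v_def intro!: clip_mono divide_right_mono)
    have "(\<Sum>i\<in>I \<times> {..<2^n}. \<bar>F (v i) - F (u i)\<bar>) < e"
    proof (rule D)
      show "finite (I \<times> {..<2 ^ n :: nat})" using fin by simp
      show "u i \<le> v i \<and> {u i..v i} \<subseteq> {0..1}" if i: "i \<in> I \<times> {..<2^n}" for i
      proof -
        obtain j k where j: "i = (j, k)" "j \<in> I" using i by blast
        have "0 \<le> a j" "b j \<le> 1" using ab[OF j(2)] by auto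
        then show ?thesis using uv[OF j(2), of k] j(1) by auto
      qed
      show "pairwise (\<lambda>i j. {u i<..<v i} \<inter> {u j<..<v j} = {}) (I \<times> {..<2 ^ n})"
      proof (rule pairwiseI)
        fix x y :: "'i \<times> nat" assume xy: "x \<in> I \<times> {..<2 ^ n}" "y \<in> I \<times> {..<2 ^ n}" "x \<noteq> y"
        obtain i k j l where [simp]: "x = (i, k)" "y = (j, l)" by (metis surj_pair)
        show "{u x<..<v x} \<inter> {u y<..<v y} = {}"
        proof (cases "i = j")
          case False
          then have "{a i<..<b i} \<inter> {a j<..<b j} = {}" using disj xy by (auto simp: pairwise_def)
          moreover have "{u x<..<v x} \<subseteq> {a i<..<b i}" "{u y<..<v y} \<subseteq> {a j<..<b j}"
            using uv[of i k] uv[of j l] xy by auto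
          ultimately show ?thesis by blast
        next
          case True
          then have "k \<noteq> l" using xy by simp
          then have "v (i, k) \<le> u (i, l) \<or> v (i, l) \<le> u (i, k)"
            using mono_uv by (meson nat_neq_iff)
          then show ?thesis using True by auto
        qed
      qed
      show "(\<Sum>i\<in>I \<times> {..<2^n}. v i - u i) < d"
      proof -
        have "(\<Sum>i\<in>I \<times> {..<2^n}. v i - u i) = (\<Sum>i\<in>I. \<Sum>k<2^n. v (i, k) - u (i, k))"
          by (subst sum.cartesian_product) (simp only: split_def prod.collapse)
        then show ?thesis using len by (simp add: tele)
      qed
    qed
    moreover have "(\<Sum>i\<in>I. dyadic_variation n F (a i) (b i)) = (\<Sum>i\<in>I \<times> {..<2^n}. \<bar>F (v i) - F (u i)\<bar>)"
      unfolding dyadic_variation_def u_def v_def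
      by (subst sum.cartesian_product) (simp only: split_def)
    ultimately show "(\<Sum>i\<in>I. dyadic_variation n F (a i) (b i)) < e" by simp
  qed
qed

text \<open>\<open>V x\<close> is the limit of the dyadic variations of \<open>F\<close> over \<open>[0,x]\<close>. The domination makes both
  \<open>V\<close> and \<open>F + V\<close> nondecreasing, which reduces absolutely continuous functions to monotone ones.\<close>
lemma absolutely_continuous_dominating_function:
  assumes F: "absolutely_continuous_on {0..1} F"
  obtains V where "absolutely_continuous_on {0..1} V"
    "\<And>x y. \<lbrakk>0 \<le> x; x \<le> y; y \<le> 1\<rbrakk> \<Longrightarrow> \<bar>F y - F x\<bar> \<le> V y - V x"
proof -
  let ?V = "\<lambda>n x. dyadic_variation n F 0 x"
  obtain d where d: "d > 0" and
    D: "\<And>(I :: unit set) a b n. \<lbrakk>finite I; \<And>i. i \<in> I \<Longrightarrow> a i \<le> b i \<and> {a i..b i} \<subseteq> {0..1};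
        pairwise (\<lambda>i j. {a i<..<b i} \<inter> {a j<..<b j} = {}) I; (\<Sum>i\<in>I. b i - a i) < d\<rbrakk>
      \<Longrightarrow> (\<Sum>i\<in>I. dyadic_variation n F (a i) (b i)) < 1"
    by (rule dyadic_variation_sum_small[OF F zero_less_one, where 'i = unit]) blast
  obtain M :: nat where M: "1 / d < real M" using reals_Archimedean2 by blast
  have M0: "0 < real M" using M d by (meson less_trans zero_less_divide_1_iff)
  \<comment> \<open>Steps of length \<open>x / M < d\<close> each add at most 1 to the variation.\<close>
  have bound: "?V n x \<le> real M" if x: "0 \<le> x" "x \<le> 1" for x n
  proof -
    have "?V n (real i * (x / M)) \<le> real i" if "i \<le> M" for i
      using that
    proof (induction i)
      case 0
      then show ?case by (simp add: dyadic_variation_def clip_def)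
    next
      case (Suc i)
      let ?a = "real i * (x / M)" and ?b = "real (Suc i) * (x / M)"
      have step: "?b - ?a = x / M" by (simp add: algebra_simps add_divide_distrib)
      have "x / M \<le> 1 / M" using x M0 by (simp add: divide_right_mono)
      also have "1 / M < d" using M M0 d by (simp add: field_simps)
      finally have small: "?b - ?a < d" using step by simp
      have ab: "0 \<le> ?a" "?a \<le> ?b" using x by (auto intro!: mult_right_mono divide_right_mono)
      have "?b \<le> real M * (x / M)" using Suc.prems x by (intro mult_right_mono) auto
      also have "\<dots> = x" using M0 by simp
      finally have b1: "?b \<le> 1" using x(2) by (rule order_trans)
      have "(\<Sum>i\<in>{()}. dyadic_variation n F ?a ?b) < 1"
        using ab b1 small by (intro D) auto
      then show ?case using dyadic_variation_diff_le[OF ab, of n F] Suc by simp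
    qed
    from this[of M] show ?thesis using M0 by simp
  qed
  have "\<exists>L. (\<lambda>n. ?V n x) \<longlonglongrightarrow> L" if x: "0 \<le> x" "x \<le> 1" for x
  proof -
    obtain L where "(\<lambda>n. ?V n x) \<longlonglongrightarrow> L"
      by (rule incseq_convergent[OF dyadic_variation_incseq, of F 0 x "real M"]) (use bound[OF x] in auto)
    then show ?thesis by blast
  qed
  then obtain V where V: "\<And>x. 0 \<le> x \<Longrightarrow> x \<le> 1 \<Longrightarrow> (\<lambda>n. ?V n x) \<longlonglongrightarrow> V x"
    by metis
  have dom: "\<bar>F y - F x\<bar> \<le> V y - V x" if xy: "0 \<le> x" "x \<le> y" "y \<le> 1" for x y
  proof -
    have "(\<lambda>n. real (nat \<lfloor>x * 2^n\<rfloor>) / 2^n) \<longlonglongrightarrow> x"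
    proof (rule real_tendsto_sandwich)
      show "\<forall>\<^sub>F n in sequentially. x - (1/2)^n \<le> real (nat \<lfloor>x * 2^n\<rfloor>) / 2^n"
      proof (intro always_eventually allI)
        fix n :: nat
        have "x - (1/2)^n = (x * 2^n - 1) / 2^n" by (simp add: field_simps power_divide)
        also have "\<dots> \<le> real (nat \<lfloor>x * 2^n\<rfloor>) / 2^n"
          by (intro divide_right_mono) (linarith, simp)
        finally show "x - (1/2)^n \<le> real (nat \<lfloor>x * 2^n\<rfloor>) / 2^n" .
      qed
      show "\<forall>\<^sub>F n in sequentially. real (nat \<lfloor>x * 2^n\<rfloor>) / 2^n \<le> x"
        using xy by (intro always_eventually allI) (simp add: field_simps)
      show "(\<lambda>n. x - (1/2)^n) \<longlonglongrightarrow> x"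
        by (rule tendsto_eq_intros LIMSEQ_power_zero refl | simp)+
    qed auto
    moreover have "real (nat \<lfloor>x * 2^n\<rfloor>) / 2^n \<in> {0..1}" for n
    proof -
      have "real (nat \<lfloor>x * 2^n\<rfloor>) \<le> x * 2^n" using xy by simp
      also have "\<dots> \<le> 2^n" using xy by simp
      finally show ?thesis by simp
    qed
    ultimately have "(\<lambda>n. F (real (nat \<lfloor>x * 2^n\<rfloor>) / 2^n)) \<longlonglongrightarrow> F x"
      using absolutely_continuous_on_imp_continuous_on[OF F] xy
      by (auto simp: continuous_on_sequentially o_def)
    then have "(\<lambda>n. \<bar>F y - F x\<bar> - 2 * \<bar>F x - F (real (nat \<lfloor>x * 2^n\<rfloor>) / 2^n)\<bar>)
        \<longlonglongrightarrow> \<bar>F y - F x\<bar> - 2 * \<bar>F x - F x\<bar>"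
      by (intro tendsto_intros)
    moreover have "(\<lambda>n. ?V n y - ?V n x) \<longlonglongrightarrow> V y - V x"
      using xy by (intro tendsto_diff V) auto
    ultimately show "\<bar>F y - F x\<bar> \<le> V y - V x"
      using dyadic_variation_diff_ge[OF xy, of F] by (auto intro: LIMSEQ_le)
  qed
  show ?thesis
  proof (rule that[OF _ dom])
    show "absolutely_continuous_on {0..1} V"
      unfolding absolutely_continuous_on_def
    proof (intro allI impI)
      fix e :: real assume e: "0 < e"
      obtain d where d: "d > 0" and
        D: "\<And>(I :: real set set) a b n. \<lbrakk>finite I; \<And>i. i \<in> I \<Longrightarrow> a i \<le> b i \<and> {a i..b i} \<subseteq> {0..1};
            pairwise (\<lambda>i j. {a i<..<b i} \<inter> {a j<..<b j} = {}) I; (\<Sum>i\<in>I. b i - a i) < d\<rbrakk>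
          \<Longrightarrow> (\<Sum>i\<in>I. dyadic_variation n F (a i) (b i)) < e / 2"
        by (rule dyadic_variation_sum_small[OF F half_gt_zero[OF e], where 'i = "real set"]) blast
      have "(\<Sum>K\<in>E. \<bar>V (Sup K) - V (Inf K)\<bar>) < e"
        if E: "E division_of T" "T \<subseteq> {0..1}" and len: "(\<Sum>K\<in>E. Sup K - Inf K) < d" for E T
      proof -
        have K: "K = {Inf K..Sup K}" "Inf K \<le> Sup K" if KE: "K \<in> E" for K
        proof -
          obtain a b where "K = cbox a b" "K \<noteq> {}" using division_ofD(3,4)[OF E(1) KE] by blast
          then show "K = {Inf K..Sup K}" "Inf K \<le> Sup K" by auto
        qed
        have sub: "{Inf K..Sup K} \<subseteq> {0..1}" if "K \<in> E" for K
          using E that K by (metis division_ofD(2) order_trans)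
        then have K01: "0 \<le> Inf K" "Sup K \<le> 1" if "K \<in> E" for K
          using K(2)[OF that] that by fastforce+
        have disj: "pairwise (\<lambda>K L. {Inf K<..<Sup K} \<inter> {Inf L<..<Sup L} = {}) E"
        proof (rule pairwiseI)
          fix X Y assume XY: "X \<in> E" "Y \<in> E" "X \<noteq> Y"
          have "interior X = {Inf X<..<Sup X}" "interior Y = {Inf Y<..<Sup Y}"
            using K XY by (metis interior_atLeastAtMost_real)+
          then show "{Inf X<..<Sup X} \<inter> {Inf Y<..<Sup Y} = {}"
            using division_ofD(5)[OF E(1) XY] by simp
        qed
        have fin: "finite E" using E(1) by blast
        have conv: "(\<lambda>n. \<Sum>K\<in>E. ?V n (Sup K) - ?V n (Inf K)) \<longlonglongrightarrow> (\<Sum>K\<in>E. V (Sup K) - V (Inf K))"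
        proof (intro tendsto_sum tendsto_diff V)
          fix K assume KE: "K \<in> E"
          show "0 \<le> Sup K" "Sup K \<le> 1" "0 \<le> Inf K" "Inf K \<le> 1"
            using K(2)[OF KE] K01[OF KE] by auto
        qed
        have "(\<Sum>K\<in>E. ?V n (Sup K) - ?V n (Inf K)) \<le> e / 2" for n
        proof -
          have "(\<Sum>K\<in>E. ?V n (Sup K) - ?V n (Inf K)) \<le> (\<Sum>K\<in>E. dyadic_variation n F (Inf K) (Sup K))"
            using K K01 by (intro sum_mono dyadic_variation_diff_le) auto
          also have "\<dots> < e / 2"
            by (rule D) (use fin K sub disj len in auto)
          finally show ?thesis by simp
        qed
        then have "(\<Sum>K\<in>E. V (Sup K) - V (Inf K)) \<le> e / 2"
          by (intro LIMSEQ_le_const2[OF conv]) auto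
        moreover have "\<bar>V (Sup K) - V (Inf K)\<bar> = V (Sup K) - V (Inf K)" if "K \<in> E" for K
          using dom[of "Inf K" "Sup K"] K(2)[OF that] K01[OF that] by auto
        ultimately have "(\<Sum>K\<in>E. \<bar>V (Sup K) - V (Inf K)\<bar>) \<le> e / 2" by simp
        then show ?thesis using e by linarith
      qed
      then show "\<exists>d>0. \<forall>E T. E division_of T \<and> T \<subseteq> {0..1} \<and> (\<Sum>K\<in>E. Sup K - Inf K) < d
          \<longrightarrow> (\<Sum>K\<in>E. \<bar>V (Sup K) - V (Inf K)\<bar>) < e"
        using d by blast
    qed
  qed
qed

lemma absolutely_continuous_on_add:
  assumes F: "absolutely_continuous_on S F" and G: "absolutely_continuous_on S G"
  shows "absolutely_continuous_on S (\<lambda>x. F x + G x)"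
  unfolding absolutely_continuous_on_def
proof (intro allI impI)
  fix e :: real assume "0 < e"
  then have e: "e / 2 > 0" by simp
  obtain d1 where d1: "d1 > 0" "\<And>D T. \<lbrakk>D division_of T; T \<subseteq> S; (\<Sum>K\<in>D. Sup K - Inf K) < d1\<rbrakk>
      \<Longrightarrow> (\<Sum>K\<in>D. \<bar>F (Sup K) - F (Inf K)\<bar>) < e / 2"
    using F e unfolding absolutely_continuous_on_def by meson
  obtain d2 where d2: "d2 > 0" "\<And>D T. \<lbrakk>D division_of T; T \<subseteq> S; (\<Sum>K\<in>D. Sup K - Inf K) < d2\<rbrakk>
      \<Longrightarrow> (\<Sum>K\<in>D. \<bar>G (Sup K) - G (Inf K)\<bar>) < e / 2"
    using G e unfolding absolutely_continuous_on_def by meson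
  have "(\<Sum>K\<in>D. \<bar>F (Sup K) + G (Sup K) - (F (Inf K) + G (Inf K))\<bar>) < e"
    if "D division_of T" "T \<subseteq> S" "(\<Sum>K\<in>D. Sup K - Inf K) < min d1 d2" for D T
  proof -
    have "(\<Sum>K\<in>D. \<bar>F (Sup K) + G (Sup K) - (F (Inf K) + G (Inf K))\<bar>)
        \<le> (\<Sum>K\<in>D. \<bar>F (Sup K) - F (Inf K)\<bar>) + (\<Sum>K\<in>D. \<bar>G (Sup K) - G (Inf K)\<bar>)"
      unfolding sum.distrib[symmetric] by (intro sum_mono) linarith
    also have "\<dots> < e / 2 + e / 2"
      using that by (intro add_strict_mono d1(2) d2(2)) auto
    finally show ?thesis by simp
  qed
  then show "\<exists>d>0. \<forall>D T. D division_of T \<and> T \<subseteq> S \<and> (\<Sum>K\<in>D. Sup K - Inf K) < d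
      \<longrightarrow> (\<Sum>K\<in>D. \<bar>F (Sup K) + G (Sup K) - (F (Inf K) + G (Inf K))\<bar>) < e"
    using d1(1) d2(1) by (intro exI[of _ "min d1 d2"]) auto
qed

text \<open>The Lebesgue--Stieltjes measure of \<open>P\<close> is absolutely continuous with respect to Lebesgue measure, so the
  Radon--Nikodym theorem supplies the density. For a null set one takes an open superset of small measure and
  covers the null set by nonoverlapping intervals inside it: every finite subfamily is a division of small total length.\<close>
lemma absolutely_continuous_mono_has_density:
  assumes P: "absolutely_continuous_on {0..1} P" and mono: "mono_on {0..1} P"
  obtains \<phi> :: "real \<Rightarrow> real" where "integrable lborel \<phi>"
    "\<And>x y. \<lbrakk>0 \<le> x; x \<le> y; y \<le> 1\<rbrakk> \<Longrightarrow> P y - P x = (LINT t:{x..y}|lborel. \<phi> t)"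
proof -
  \<comment> \<open>Extending by constants gives a Stieltjes measure that vanishes outside the unit interval.\<close>
  define Q where "Q x = P (max 0 (min 1 x))" for x :: real
  have Qmono: "Q x \<le> Q y" if "x \<le> y" for x y
    using that unfolding Q_def by (intro mono_onD[OF mono]) auto
  have "continuous_on UNIV (P \<circ> (\<lambda>x. max 0 (min 1 x)))"
    by (intro continuous_on_compose continuous_intros
        continuous_on_subset[OF absolutely_continuous_on_imp_continuous_on[OF P]]) auto
  then have Qcont: "continuous_on UNIV Q" unfolding Q_def[abs_def] by (simp add: o_def)
  define \<mu> where "\<mu> = interval_measure Q"
  have \<mu>Icc: "emeasure \<mu> {x..y} = ennreal (Q y - Q x)" if "x \<le> y" for x y
    unfolding \<mu>_def using that Qmono Qcont by (intro emeasure_interval_measure_Icc) auto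
  have sets_\<mu>[measurable_cong]: "sets \<mu> = sets borel" and space_\<mu>: "space \<mu> = UNIV"
    by (auto simp: \<mu>_def)
  have null: "emeasure \<mu> (N \<inter> {0..1}) = 0" if N: "N \<in> null_sets lborel" for N
  proof -
    have Nb: "N \<in> sets borel" and N0: "emeasure lborel N = 0" using N by auto
    have "emeasure \<mu> (N \<inter> {0..1}) \<le> ennreal e" if e: "e > 0" for e
    proof -
      obtain d where d: "d > 0" "\<And>D T. \<lbrakk>D division_of T; T \<subseteq> {0..1}; (\<Sum>K\<in>D. Sup K - Inf K) < d\<rbrakk>
          \<Longrightarrow> (\<Sum>K\<in>D. \<bar>P (Sup K) - P (Inf K)\<bar>) < e"
        using P e unfolding absolutely_continuous_on_def by meson
      have "N \<in> sets lebesgue" using Nb by simp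
      then obtain U where U: "open U" "N \<subseteq> U" "emeasure lebesgue (U - N) < ennreal d"
        using d(1) by (rule sets_lebesgue_outer_open)
      have Ub: "U \<in> sets borel" using U(1) by simp
      have "N \<union> (U - N) = U" using U(2) by blast
      then have "emeasure lebesgue U \<le> emeasure lebesgue N + emeasure lebesgue (U - N)"
        using emeasure_subadditive[of N lebesgue "U - N"] Ub Nb by simp
      then have Ud: "emeasure lebesgue U < ennreal d" using N0 U(3) Nb by simp
      have "\<exists>r>0. ball x r \<subseteq> U" if "x \<in> U" for x using U(1) that by (simp add: open_contains_ball)
      then obtain \<rho> where \<rho>: "\<And>x. x \<in> U \<Longrightarrow> \<rho> x > 0 \<and> ball x (\<rho> x) \<subseteq> U" by metis
      define g where "g x = (if x \<in> U then ball x (\<rho> x) else ball x 1)" for x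
      have "gauge g" using \<rho> by (force simp: gauge_def g_def)
      obtain \<D> where \<D>: "countable \<D>" "\<Union>\<D> \<subseteq> cbox 0 (1::real)"
        "\<And>K. K \<in> \<D> \<Longrightarrow> interior K \<noteq> {} \<and> (\<exists>c d. K = cbox c d)"
        "pairwise (\<lambda>A B. interior A \<inter> interior B = {}) \<D>"
        "\<And>K. K \<in> \<D> \<Longrightarrow> \<exists>x \<in> (N \<inter> {0..1}) \<inter> K. K \<subseteq> g x"
        "N \<inter> {0..1} \<subseteq> \<Union>\<D>"
        by (rule covering_lemma[of "N \<inter> {0..1}" 0 1 g]) (use \<open>gauge g\<close> in \<open>auto simp: box_real\<close>)
      have KU: "K \<subseteq> U" if "K \<in> \<D>" for K
        using \<D>(5)[OF that] U(2) \<rho> by (fastforce simp: g_def)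
      have Kcb: "K = {Inf K..Sup K}" "Inf K \<le> Sup K" "0 \<le> Inf K" "Sup K \<le> 1" if "K \<in> \<D>" for K
      proof -
        obtain a b where ab: "K = cbox a b" "K \<noteq> {}" using \<D>(3)[OF \<open>K \<in> \<D>\<close>] by fastforce
        then show "K = {Inf K..Sup K}" "Inf K \<le> Sup K" by auto
        have "K \<subseteq> {0..1}" using \<D>(2) \<open>K \<in> \<D>\<close> by (metis Union_upper cbox_interval order_trans)
        then show "0 \<le> Inf K" "Sup K \<le> 1" using ab by auto
      qed
      have fin: "(\<Sum>K\<in>\<F>. emeasure \<mu> K) \<le> ennreal e" if \<F>: "finite \<F>" "\<F> \<subseteq> \<D>" for \<F>
      proof -
        have div: "\<F> division_of \<Union>\<F>"
        proof (rule division_ofI)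
          fix K assume "K \<in> \<F>"
          then have "K \<in> \<D>" using \<F> by blast
          then show "\<exists>a b. K = cbox a b" "K \<noteq> {}" using \<D>(3)[of K] by auto
          fix L assume "L \<in> \<F>" "K \<noteq> L"
          then show "interior K \<inter> interior L = {}"
            using \<D>(4) \<F> \<open>K \<in> \<D>\<close> by (auto simp: pairwise_def)
        qed (use \<F> in auto)
        have "(\<Sum>K\<in>\<F>. Sup K - Inf K) = (\<Sum>K\<in>\<F>. measure lebesgue K)"
        proof (intro sum.cong refl)
          fix K assume "K \<in> \<F>"
          then have KD: "K \<in> \<D>" using \<F> by blast
          have "measure lebesgue {Inf K..Sup K} = Sup K - Inf K" using Kcb(2)[OF KD] by simp
          then show "Sup K - Inf K = measure lebesgue K" using Kcb(1)[OF KD] by simp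
        qed
        also have "\<dots> = measure lebesgue (\<Union>\<F>)"
          using content_division[OF div] by simp
        finally have len: "ennreal (\<Sum>K\<in>\<F>. Sup K - Inf K) = emeasure lebesgue (\<Union>\<F>)"
          using lmeasurable_division[OF div] by (simp add: emeasure_eq_measure2)
        have "\<Union>\<F> \<subseteq> U" using KU \<F> by blast
        then have "emeasure lebesgue (\<Union>\<F>) \<le> emeasure lebesgue U"
          using Ub by (intro emeasure_mono) auto
        then have "ennreal (\<Sum>K\<in>\<F>. Sup K - Inf K) < ennreal d" using len Ud by simp
        then have "(\<Sum>K\<in>\<F>. Sup K - Inf K) < d" by (meson ennreal_leI not_le)
        moreover have "\<Union>\<F> \<subseteq> {0..1}" using \<D>(2) \<F> by auto
        ultimately have *: "(\<Sum>K\<in>\<F>. \<bar>P (Sup K) - P (Inf K)\<bar>) < e" by (intro d(2)[OF div])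
        have "(\<Sum>K\<in>\<F>. emeasure \<mu> K) = (\<Sum>K\<in>\<F>. ennreal \<bar>P (Sup K) - P (Inf K)\<bar>)"
        proof (intro sum.cong refl)
          fix K assume "K \<in> \<F>"
          then have KD: "K \<in> \<D>" using \<F> by blast
          have "emeasure \<mu> K = ennreal (Q (Sup K) - Q (Inf K))"
            using \<mu>Icc[OF Kcb(2)[OF KD]] Kcb(1)[OF KD] by simp
          moreover have "Q (Sup K) = P (Sup K)" "Q (Inf K) = P (Inf K)"
            using Kcb(2-4)[OF KD] by (auto simp: Q_def)
          moreover have "Q (Inf K) \<le> Q (Sup K)" using Qmono Kcb(2)[OF KD] by blast
          ultimately show "emeasure \<mu> K = ennreal \<bar>P (Sup K) - P (Inf K)\<bar>" by simp
        qed
        also have "\<dots> = ennreal (\<Sum>K\<in>\<F>. \<bar>P (Sup K) - P (Inf K)\<bar>)" by simp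
        also have "\<dots> \<le> ennreal e" using * by (intro ennreal_leI) simp
        finally show ?thesis .
      qed
      have K_sets: "K \<in> sets \<mu>" if "K \<in> \<D>" for K
        using Kcb(1)[OF that] sets_\<mu> by (metis atLeastAtMost_borel)
      show ?thesis
      proof (cases "\<D> = {}")
        case True
        then show ?thesis using \<D>(6) by simp
      next
        case False
        define A where "A = from_nat_into \<D>"
        have A: "range A = \<D>" using range_from_nat_into[OF False \<D>(1)] by (simp add: A_def)
        define B where "B n = \<Union> (A ` {..<n})" for n :: nat
        have "emeasure \<mu> (B n) \<le> ennreal e" for n
        proof -
          have "emeasure \<mu> (\<Union>K\<in>A ` {..<n}. K) \<le> (\<Sum>K\<in>A ` {..<n}. emeasure \<mu> K)"
            using A K_sets by (intro emeasure_subadditive_finite) auto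
          also have "\<dots> \<le> ennreal e" using A by (intro fin) auto
          finally show ?thesis by (simp add: B_def)
        qed
        moreover have "(SUP n. emeasure \<mu> (B n)) = emeasure \<mu> (\<Union>n. B n)"
        proof (rule SUP_emeasure_incseq)
          show "range B \<subseteq> sets \<mu>" using A K_sets by (auto simp: B_def)
          show "incseq B" by (force simp: B_def incseq_def)
        qed
        ultimately have "emeasure \<mu> (\<Union>n. B n) \<le> ennreal e"
          by (metis SUP_least)
        moreover have "N \<inter> {0..1} \<subseteq> (\<Union>n. B n)"
          using \<D>(6) unfolding A[symmetric] B_def by blast
        moreover have "(\<Union>n. B n) \<in> sets \<mu>" using A K_sets by (auto simp: B_def)
        ultimately show ?thesis by (meson emeasure_mono order_trans)
      qed
    qed
    then have "emeasure \<mu> (N \<inter> {0..1}) \<le> 0 + ennreal e" if "e > 0" for e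
      using that by (simp only: add_0)
    then have "emeasure \<mu> (N \<inter> {0..1}) \<le> 0"
      by (rule ennreal_le_epsilon)
    then show ?thesis by simp
  qed
  have out: "emeasure \<mu> (- {0..1}) = 0"
  proof -
    have "{- real n..0} \<union> {1..1 + real n} \<in> null_sets \<mu>" for n
    proof (rule null_sets.Un)
      show "{- real n..0} \<in> null_sets \<mu>" "{1..1 + real n} \<in> null_sets \<mu>"
        using \<mu>Icc[of "- real n" 0] \<mu>Icc[of 1 "1 + real n"]
        by (intro null_setsI; simp add: sets_\<mu> Q_def)+
    qed
    then have *: "(\<Union>n. {- real n..0} \<union> {1..1 + real n}) \<in> null_sets \<mu>"
      by (rule null_sets_UN)
    have "- {0..1} \<subseteq> (\<Union>n. {- real n..0} \<union> {1..1 + real n})"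
    proof
      fix x :: real assume x: "x \<in> - {0..1}"
      obtain n where "\<bar>x\<bar> < real n" using reals_Archimedean2 by blast
      then show "x \<in> (\<Union>n. {- real n..0} \<union> {1..1 + real n})"
        using x by (intro UN_I[of n]) auto
    qed
    then have "- {0..1} \<in> null_sets \<mu>"
      by (rule null_sets_subset[OF *, rotated]) (simp add: sets_\<mu>)
    then show ?thesis by auto
  qed
  have "absolutely_continuous lborel \<mu>"
    unfolding absolutely_continuous_def
  proof
    fix N :: "real set" assume N: "N \<in> null_sets lborel"
    then have Nb: "N \<in> sets borel" by auto
    have "emeasure \<mu> N \<le> emeasure \<mu> (N \<inter> {0..1} \<union> - {0..1})"
      using Nb by (intro emeasure_mono) auto
    also have "\<dots> \<le> emeasure \<mu> (N \<inter> {0..1}) + emeasure \<mu> (- {0..1})"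
      using Nb by (intro emeasure_subadditive) auto
    finally show "N \<in> null_sets \<mu>" using null[OF N] out Nb by (auto simp: null_sets_def sets_\<mu>)
  qed
  then obtain \<phi> where \<phi>[measurable]: "\<phi> \<in> borel_measurable lborel" and dens: "density lborel \<phi> = \<mu>"
    using sigma_finite_measure.Radon_Nikodym[OF lborel.sigma_finite_measure_axioms, of \<mu>] sets_\<mu>
    by auto
  have \<phi>Icc: "(\<integral>\<^sup>+t. \<phi> t * indicator {x..y} t \<partial>lborel) = ennreal (Q y - Q x)" if "x \<le> y" for x y
    using \<mu>Icc[OF that] unfolding dens[symmetric] by (simp add: emeasure_density)
  have tot: "(\<integral>\<^sup>+t. \<phi> t * indicator {0..1} t \<partial>lborel) < \<infinity>"
    using \<phi>Icc[of 0 1] by simp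
  then have ae: "AE t in lborel. \<phi> t * indicator {0..1} t \<noteq> \<infinity>"
    by (intro nn_integral_PInf_AE) auto
  define \<psi> where "\<psi> t = enn2real (\<phi> t * indicator {0..1} t)" for t :: real
  have \<psi>m[measurable]: "\<psi> \<in> borel_measurable borel" unfolding \<psi>_def by measurable
  have \<psi>eq: "AE t in lborel. ennreal (\<psi> t) = \<phi> t * indicator {0..1} t"
    using ae by eventually_elim (auto simp: \<psi>_def less_top)
  have "(\<integral>\<^sup>+t. ennreal (\<psi> t) \<partial>lborel) < \<infinity>"
    using tot nn_integral_cong_AE[OF \<psi>eq] by simp
  then have int: "integrable lborel \<psi>"
    by (intro integrableI_nonneg) (auto simp: \<psi>_def)
  show ?thesis
  proof (rule that[OF int])
    fix x y :: real assume xy: "0 \<le> x" "x \<le> y" "y \<le> 1"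
    have "ennreal (LINT t:{x..y}|lborel. \<psi> t) = (\<integral>\<^sup>+t. ennreal (indicator {x..y} t * \<psi> t) \<partial>lborel)"
      unfolding set_lebesgue_integral_def real_scaleR_def
      using integrable_mult_indicator[OF _ int, of "{x..y}"]
      by (intro nn_integral_eq_integral[symmetric]) (auto simp: \<psi>_def)
    also have "\<dots> = (\<integral>\<^sup>+t. \<phi> t * indicator {x..y} t \<partial>lborel)"
    proof (rule nn_integral_cong_AE)
      show "AE t in lborel. ennreal (indicator {x..y} t * \<psi> t) = \<phi> t * indicator {x..y} t"
        using \<psi>eq
      proof eventually_elim
        case (elim t)
        show ?case
        proof (cases "t \<in> {x..y}")
          case True
          then have "t \<in> {0..1}" using xy by auto
          then show ?thesis using True elim by simp
        qed simp
      qed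
    qed
    also have "\<dots> = ennreal (P y - P x)" using \<phi>Icc[OF xy(2)] xy by (simp add: Q_def)
    finally show "P y - P x = (LINT t:{x..y}|lborel. \<psi> t)"
      using mono_onD[OF mono, of x y] xy
      by (subst (asm) ennreal_inj) (auto simp: set_lebesgue_integral_def \<psi>_def intro!: integral_nonneg)
  qed
qed

text \<open>Averages over \<open>[x, x + h]\<close> give the right derivative. For the left one, averages of \<open>\<phi>\<close> to the left of \<open>x\<close>
  are averages of \<open>\<lambda>t. \<phi> (- t)\<close> to the right of \<open>- x\<close>.\<close>
lemma AE_has_vector_derivative_indefinite_integral:
  fixes \<phi> :: "real \<Rightarrow> real"
  assumes int: "integrable lborel \<phi>"
    and F: "\<And>x y. \<lbrakk>a \<le> x; x \<le> y; y \<le> b\<rbrakk> \<Longrightarrow> F y - F x = (LINT t:{x..y}|lborel. \<phi> t)"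
  shows "AE x in lborel. x \<in> {a<..<b} \<longrightarrow> (F has_vector_derivative \<phi> x) (at x)"
proof -
  have HK: "f integrable_on cbox c d" "integral {c..d} f = (LINT t:{c..d}|lborel. f t)"
    if "integrable lborel f" for f :: "real \<Rightarrow> real" and c d
  proof -
    have "set_integrable lborel {c..d} f"
      using integrable_mult_indicator[OF _ that, of "{c..d}"] by (simp add: set_integrable_def)
    from set_borel_integral_eq_integral[OF this]
    show "f integrable_on cbox c d" "integral {c..d} f = (LINT t:{c..d}|lborel. f t)" by auto
  qed
  have int': "integrable lborel (\<lambda>t. \<phi> (- t))"
    using lborel_integrable_real_affine[OF int, of "-1" 0] by simp
  obtain N1 where N1: "negligible N1" "\<And>x e. \<lbrakk>x \<notin> N1; 0 < e\<rbrakk> \<Longrightarrow>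
      \<exists>d>0. \<forall>h. 0 < h \<and> h < d \<longrightarrow> norm (integral (cbox x (x + h *\<^sub>R One)) \<phi> /\<^sub>R h ^ DIM(real) - \<phi> x) < e"
    by (rule integrable_ccontinuous_explicit[of \<phi>]) (use HK(1)[OF int] in blast)+
  obtain N2 where N2: "negligible N2" "\<And>x e. \<lbrakk>x \<notin> N2; 0 < e\<rbrakk> \<Longrightarrow>
      \<exists>d>0. \<forall>h. 0 < h \<and> h < d \<longrightarrow> norm (integral (cbox x (x + h *\<^sub>R One)) (\<lambda>t. \<phi> (- t)) /\<^sub>R h ^ DIM(real) - \<phi> (- x)) < e"
    by (rule integrable_ccontinuous_explicit[of "\<lambda>t. \<phi> (- t)"]) (use HK(1)[OF int'] in blast)+
  define N where "N = N1 \<union> uminus ` N2"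
  have "negligible (uminus ` N2)"
    using N2(1) by (intro negligible_differentiable_image_negligible)
      (auto simp: differentiable_on_def intro!: derivative_intros)
  then have "negligible N" using N1(1) by (simp add: N_def)
  then have ae: "AE x in lebesgue. x \<notin> N"
    by (simp add: AE_not_in negligible_iff_null_sets)
  have "(F has_vector_derivative \<phi> x) (at x)"
    if x: "x \<notin> N" "x \<in> {a<..<b}" for x
  proof -
    have "((\<lambda>y. (F y - F x) / (y - x)) \<longlongrightarrow> \<phi> x) (at x)"
      unfolding Lim_at
    proof (intro allI impI)
      fix e :: real assume e: "0 < e"
      have xN1: "x \<notin> N1" and xN2: "- x \<notin> N2" using x(1) by (force simp: N_def)+
      obtain d1 where d1: "d1 > 0" "\<And>h. 0 < h \<Longrightarrow> h < d1 \<Longrightarrow> \<bar>integral {x..x + h} \<phi> / h - \<phi> x\<bar> < e"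
        using N1(2)[OF xN1 e] by (auto simp: divide_inverse mult.commute)
      obtain d2 where d2: "d2 > 0"
        "\<And>h. 0 < h \<Longrightarrow> h < d2 \<Longrightarrow> \<bar>integral {- x..- x + h} (\<lambda>t. \<phi> (- t)) / h - \<phi> x\<bar> < e"
        using N2(2)[OF xN2 e] by (auto simp: divide_inverse mult.commute)
      define d where "d = Min {d1, d2, x - a, b - x}"
      have d: "d > 0" "d \<le> d1" "d \<le> d2" "d \<le> x - a" "d \<le> b - x"
        using d1 d2 x(2) by (auto simp: d_def)
      have "\<bar>(F y - F x) / (y - x) - \<phi> x\<bar> < e" if y: "0 < dist y x" "dist y x < d" for y
      proof (cases "x < y")
        case True
        then have "F y - F x = integral {x..x + (y - x)} \<phi>"
          using F[of x y] HK(2)[OF int, of x y] y d x by (auto simp: dist_real_def)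
        then show ?thesis using d1(2)[of "y - x"] True y d by (auto simp: dist_real_def)
      next
        case False
        then have yx: "y < x" using y by auto
        have "integral {- x..- x + (x - y)} (\<lambda>t. \<phi> (- t)) = integral {y..x} \<phi>"
          using Henstock_Kurzweil_Integration.integral_reflect_real[of y x \<phi>] by simp
        also have "\<dots> = F x - F y"
          using F[of y x] HK(2)[OF int, of y x] y yx d x by (auto simp: dist_real_def)
        finally have "integral {- x..- x + (x - y)} (\<lambda>t. \<phi> (- t)) / (x - y) = (F y - F x) / (y - x)"
          using minus_divide_divide[of "F y - F x" "y - x"] by simp
        then show ?thesis using d2(2)[of "x - y"] yx y d by (auto simp: dist_real_def)
      qed
      then show "\<exists>d>0. \<forall>y. 0 < dist y x \<and> dist y x < d \<longrightarrow> dist ((F y - F x) / (y - x)) (\<phi> x) < e"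
        using d(1) by (auto simp: dist_real_def)
    qed
    then show ?thesis
      by (simp add: has_real_derivative_iff_has_vector_derivative[symmetric] has_field_derivative_iff)
  qed
  then have "x \<in> {a<..<b} \<longrightarrow> (F has_vector_derivative \<phi> x) (at x)" if "x \<notin> N" for x
    using that by blast
  then have "AE x in lebesgue. x \<in> {a<..<b} \<longrightarrow> (F has_vector_derivative \<phi> x) (at x)"
    using ae by (rule eventually_mono[rotated])
  then show ?thesis by (simp add: AE_completion_iff)
qed

theorem absolutely_continuous_imp_indefinite_integral:
  assumes F: "absolutely_continuous_on {0..1} F"
  obtains \<phi> :: "real \<Rightarrow> real" where "integrable lborel \<phi>"
    "\<And>x y. \<lbrakk>0 \<le> x; x \<le> y; y \<le> 1\<rbrakk> \<Longrightarrow> F y - F x = (LINT t:{x..y}|lborel. \<phi> t)"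
    "AE x in lborel. x \<in> {0..1} \<longrightarrow> vector_derivative F (at x within {0..1}) = \<phi> x"
proof -
  obtain V where V: "absolutely_continuous_on {0..1} V"
    and dom: "\<And>x y. \<lbrakk>0 \<le> x; x \<le> y; y \<le> 1\<rbrakk> \<Longrightarrow> \<bar>F y - F x\<bar> \<le> V y - V x"
    using absolutely_continuous_dominating_function[OF F] by blast
  have mono1: "mono_on {0..1} V" and mono2: "mono_on {0..1} (\<lambda>x. F x + V x)"
    using dom by (intro mono_onI; fastforce)+
  obtain \<phi>1 where i1: "integrable lborel \<phi>1"
    and 1: "\<And>x y. \<lbrakk>0 \<le> x; x \<le> y; y \<le> 1\<rbrakk> \<Longrightarrow> V y - V x = (LINT t:{x..y}|lborel. \<phi>1 t)"
    using absolutely_continuous_mono_has_density[OF V mono1] by blast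
  obtain \<phi>2 where i2: "integrable lborel \<phi>2"
    and 2: "\<And>x y. \<lbrakk>0 \<le> x; x \<le> y; y \<le> 1\<rbrakk> \<Longrightarrow> F y + V y - (F x + V x) = (LINT t:{x..y}|lborel. \<phi>2 t)"
    using absolutely_continuous_mono_has_density[OF absolutely_continuous_on_add[OF F V] mono2] by blast
  have set_int: "set_integrable lborel {x..y} f" if "integrable lborel f" for f :: "real \<Rightarrow> real" and x y
    using integrable_mult_indicator[OF _ that, of "{x..y}"] by (simp add: set_integrable_def)
  let ?\<phi> = "\<lambda>t. \<phi>2 t - \<phi>1 t"
  have int: "integrable lborel ?\<phi>" using i1 i2 by simp
  have F_eq: "F y - F x = (LINT t:{x..y}|lborel. ?\<phi> t)" if "0 \<le> x" "x \<le> y" "y \<le> 1" for x y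
    using 1[OF that] 2[OF that] set_integral_diff(2)[OF set_int[OF i2] set_int[OF i1], of x y]
    by simp
  have "AE x in lborel. x \<notin> {0, 1::real}"
    by (intro AE_not_in) (auto intro: finite_imp_null_set_lborel)
  moreover have "AE x in lborel. x \<in> {0<..<1} \<longrightarrow> (F has_vector_derivative ?\<phi> x) (at x)"
    using F_eq by (intro AE_has_vector_derivative_indefinite_integral[OF int]) auto
  ultimately have "AE x in lborel. x \<in> {0..1} \<longrightarrow> vector_derivative F (at x within {0..1}) = ?\<phi> x"
  proof eventually_elim
    case (elim x)
    show ?case
    proof
      assume "x \<in> {0..1}"
      then have "0 < x" "x < 1" using elim(1) by (auto simp: less_le)
      then have "(F has_vector_derivative ?\<phi> x) (at x)" using elim(2) by auto
      then show "vector_derivative F (at x within {0..1}) = ?\<phi> x"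
        using vector_derivative_within_cbox[of 0 1 x F "?\<phi> x"] \<open>0 < x\<close> \<open>x < 1\<close>
          has_vector_derivative_at_within[of F "?\<phi> x" x "{0..1}"] by simp
    qed
  qed
  then show ?thesis using int F_eq that by blast
qed

section \<open>Finite differences of iterated primitives\<close>

text \<open>Stated by integrals rather than derivatives, so that at the top level \<open>f'\<close> may be any Borel representative
  of an almost everywhere derivative.\<close>
definition primitive_on_unit :: "(real \<Rightarrow> real) \<Rightarrow> (real \<Rightarrow> real) \<Rightarrow> bool" where
  "primitive_on_unit f' f \<longleftrightarrow> set_integrable lborel {0..1} f' \<and>
     (\<forall>x y. 0 \<le> x \<longrightarrow> x \<le> y \<longrightarrow> y \<le> 1 \<longrightarrow> f y - f x = (LINT t:{x..y}|lborel. f' t))"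

lemma finite_difference_Suc:
  "finite_difference (Suc s) h f x = finite_difference s h f x - finite_difference s h f (x + h)"
proof -
  have "finite_difference s h f x
      = (\<Sum>\<nu>\<le>Suc s. real (s choose \<nu>) * (- 1) ^ \<nu> * f (x + real \<nu> * h))"
    by (simp add: finite_difference_def binomial_eq_0)
  also have "\<dots> = f x + (\<Sum>\<nu>\<le>s. real (s choose Suc \<nu>) * (- 1) ^ Suc \<nu> * f (x + real (Suc \<nu>) * h))"
    by (subst sum.atMost_Suc_shift) simp
  finally have 1: "finite_difference s h f x
      = f x + (\<Sum>\<nu>\<le>s. real (s choose Suc \<nu>) * (- 1) ^ Suc \<nu> * f (x + real (Suc \<nu>) * h))" .
  have 2: "- finite_difference s h f (x + h)
      = (\<Sum>\<nu>\<le>s. real (s choose \<nu>) * (- 1) ^ Suc \<nu> * f (x + real (Suc \<nu>) * h))"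
    unfolding finite_difference_def sum_negf[symmetric]
    by (intro sum.cong refl) (simp add: algebra_simps)
  have "finite_difference (Suc s) h f x
      = f x + (\<Sum>\<nu>\<le>s. real (Suc s choose Suc \<nu>) * (- 1) ^ Suc \<nu> * f (x + real (Suc \<nu>) * h))"
    unfolding finite_difference_def by (subst sum.atMost_Suc_shift) simp
  also have "\<dots> = f x + (\<Sum>\<nu>\<le>s. real (s choose Suc \<nu>) * (- 1) ^ Suc \<nu> * f (x + real (Suc \<nu>) * h))
      + (\<Sum>\<nu>\<le>s. real (s choose \<nu>) * (- 1) ^ Suc \<nu> * f (x + real (Suc \<nu>) * h))"
    unfolding add.assoc sum.distrib[symmetric] by (simp add: algebra_simps)
  also have "\<dots> = finite_difference s h f x - finite_difference s h f (x + h)"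
    using 1 2 by simp
  finally show ?thesis .
qed

lemma finite_difference_commute:
  "finite_difference m t (finite_difference k h f) x
     = (\<Sum>\<nu>\<le>k. real (k choose \<nu>) * (- 1) ^ \<nu> * finite_difference m t f (x + real \<nu> * h))"
  unfolding finite_difference_def sum_distrib_left
  by (subst sum.swap) (simp add: algebra_simps)

lemma abs_finite_difference_le:
  "\<bar>finite_difference s h f x\<bar> \<le> (\<Sum>\<nu>\<le>s. real (s choose \<nu>) * \<bar>f (x + real \<nu> * h)\<bar>)"
  unfolding finite_difference_def
  by (rule order_trans[OF sum_abs]) (simp add: abs_mult power_abs)

lemma borel_measurable_finite_difference [measurable (raw)]:
  assumes [measurable]: "f \<in> borel_measurable borel" "a \<in> borel_measurable M" "b \<in> borel_measurable M"
  shows "(\<lambda>w. finite_difference s (a w) f (b w)) \<in> borel_measurable M"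
  unfolding finite_difference_def by measurable

text \<open>Since \<open>\<Delta>\<^sub>h\<^sup>s\<^sup>+\<^sup>1 f(x) = \<Delta>\<^sub>h\<^sup>s f(x) - \<Delta>\<^sub>h\<^sup>s f(x + h)\<close>, the difference on the left is minus the integral of
  \<open>\<Delta>\<^sub>h\<^sup>s f'\<close> over \<open>[x, x + h]\<close>.\<close>
lemma finite_difference_Suc_le_integral:
  assumes prim: "primitive_on_unit f' f" and x: "0 \<le> x" "0 < h" "x + real (Suc s) * h \<le> 1"
  shows "ennreal \<bar>finite_difference (Suc s) h f x\<bar>
     \<le> (\<integral>\<^sup>+y\<in>{x..x + h}. ennreal \<bar>finite_difference s h f' y\<bar> \<partial>lborel)"
proof -
  let ?I = "\<lambda>y. indicator {x..x + h} y :: real"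
  let ?c = "\<lambda>\<nu>. real (s choose \<nu>) * (- 1) ^ \<nu>"
  have int: "integrable lborel (\<lambda>y. ?I y * f' (y + real \<nu> * h))"
    and val: "f (x + h + real \<nu> * h) - f (x + real \<nu> * h) = (LINT y|lborel. ?I y * f' (y + real \<nu> * h))"
    if \<nu>: "\<nu> \<le> s" for \<nu>
  proof -
    let ?a = "x + real \<nu> * h" and ?b = "x + h + real \<nu> * h"
    have "real \<nu> * h \<le> real s * h" using \<nu> x by (intro mult_right_mono) auto
    moreover have "x + h + real s * h \<le> 1" using x(3) by (simp add: algebra_simps)
    ultimately have "?b \<le> 1" by linarith
    with x have ab: "0 \<le> ?a" "?a \<le> ?b" "?b \<le> 1" by auto
    have "set_integrable lborel {?a..?b} f'"
      using prim ab unfolding primitive_on_unit_def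
      by (auto intro: set_integrable_subset)
    then have i: "integrable lborel (\<lambda>t. indicator {?a..?b} t * f' t)"
      by (simp add: set_integrable_def)
    have shift: "(\<lambda>y. indicator {?a..?b} (real \<nu> * h + 1 * y) * f' (real \<nu> * h + 1 * y)) =
        (\<lambda>y. ?I y * f' (y + real \<nu> * h))"
      by (auto simp: fun_eq_iff indicator_def add.commute)
    show "integrable lborel (\<lambda>y. ?I y * f' (y + real \<nu> * h))"
      using lborel_integrable_real_affine[OF i, of 1 "real \<nu> * h"] unfolding shift by simp
    have "f ?b - f ?a = (LINT t|lborel. indicator {?a..?b} t * f' t)"
      using prim ab unfolding primitive_on_unit_def by (simp add: set_lebesgue_integral_def)
    also have "\<dots> = (LINT y|lborel. ?I y * f' (y + real \<nu> * h))"
      by (subst lborel_integral_real_affine[where c = 1 and t = "real \<nu> * h"]) (simp_all only: shift, auto)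
    finally show "f ?b - f ?a = (LINT y|lborel. ?I y * f' (y + real \<nu> * h))" .
  qed
  have sum_eq: "(\<Sum>\<nu>\<le>s. ?c \<nu> * (?I y * f' (y + real \<nu> * h))) = ?I y * finite_difference s h f' y" for y
    by (simp add: finite_difference_def sum_distrib_left algebra_simps)
  have "integrable lborel (\<lambda>y. \<Sum>\<nu>\<le>s. ?c \<nu> * (?I y * f' (y + real \<nu> * h)))"
    using int by (intro Bochner_Integration.integrable_sum integrable_mult_right) auto
  then have int': "integrable lborel (\<lambda>y. ?I y * finite_difference s h f' y)"
    by (simp only: sum_eq)
  have "- finite_difference (Suc s) h f x = (\<Sum>\<nu>\<le>s. ?c \<nu> * (f (x + h + real \<nu> * h) - f (x + real \<nu> * h)))"
    unfolding finite_difference_Suc by (simp add: finite_difference_def sum_subtractf algebra_simps)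
  also have "\<dots> = (\<Sum>\<nu>\<le>s. (LINT y|lborel. ?c \<nu> * (?I y * f' (y + real \<nu> * h))))"
    by (intro sum.cong refl) (simp add: val)
  also have "\<dots> = (LINT y|lborel. (\<Sum>\<nu>\<le>s. ?c \<nu> * (?I y * f' (y + real \<nu> * h))))"
    using int by (intro Bochner_Integration.integral_sum[symmetric] integrable_mult_right) auto
  finally have "\<bar>finite_difference (Suc s) h f x\<bar> = norm (LINT y|lborel. ?I y * finite_difference s h f' y)"
    by (simp add: sum_eq flip: abs_minus_cancel[of "finite_difference (Suc s) h f x"])
  also have "ennreal \<dots> \<le> (\<integral>\<^sup>+y. ennreal (norm (?I y * finite_difference s h f' y)) \<partial>lborel)"
    by (rule integral_norm_bound_ennreal[OF int'])
  also have "\<dots> = (\<integral>\<^sup>+y\<in>{x..x + h}. ennreal \<bar>finite_difference s h f' y\<bar> \<partial>lborel)"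
    by (intro nn_integral_cong) (auto simp: indicator_def)
  finally show ?thesis .
qed

text \<open>Each further primitive adds an integration over an interval of length \<open>h\<close>. All that is kept of the resulting
  B-spline kernel is its support, of length \<open>(n + 1) h\<close>, and the bound \<open>h\<^sup>n\<close> for it.\<close>
lemma finite_difference_le_iterated:
  assumes "\<And>j. j \<le> n \<Longrightarrow> primitive_on_unit (D (Suc j)) (D j)"
    and "0 \<le> x" "0 < h" "x + real (k + Suc n) * h \<le> 1"
  shows "ennreal \<bar>finite_difference (k + Suc n) h (D 0) x\<bar>
     \<le> ennreal (h ^ n) * (\<integral>\<^sup>+y\<in>{x..x + real (Suc n) * h}. ennreal \<bar>finite_difference k h (D (Suc n)) y\<bar> \<partial>lborel)"
  using assms
proof (induction n arbitrary: D x)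
  case 0
  then show ?case using finite_difference_Suc_le_integral[of "D 1" "D 0" x h k] by simp
next
  case (Suc n)
  let ?J = "\<integral>\<^sup>+y\<in>{x..x + real (Suc (Suc n)) * h}. ennreal \<bar>finite_difference k h (D (Suc (Suc n))) y\<bar> \<partial>lborel"
  have "ennreal \<bar>finite_difference (k + Suc (Suc n)) h (D 0) x\<bar>
      \<le> (\<integral>\<^sup>+y\<in>{x..x + h}. ennreal \<bar>finite_difference (k + Suc n) h (D (Suc 0)) y\<bar> \<partial>lborel)"
    using finite_difference_Suc_le_integral[of "D (Suc 0)" "D 0" x h "k + Suc n"] Suc.prems by simp
  also have "\<dots> \<le> (\<integral>\<^sup>+y\<in>{x..x + h}. ennreal (h ^ n) * ?J \<partial>lborel)"
  proof (intro nn_integral_mono)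
    fix y :: real
    show "ennreal \<bar>finite_difference (k + Suc n) h (D (Suc 0)) y\<bar> * indicator {x..x + h} y
        \<le> ennreal (h ^ n) * ?J * indicator {x..x + h} y"
    proof (cases "y \<in> {x..x + h}")
      case True
      have "y + real (k + Suc n) * h \<le> 1" using True Suc.prems(4) by (simp add: algebra_simps)
      then have "ennreal \<bar>finite_difference (k + Suc n) h (D (Suc 0)) y\<bar> \<le> ennreal (h ^ n) *
          (\<integral>\<^sup>+z\<in>{y..y + real (Suc n) * h}. ennreal \<bar>finite_difference k h (D (Suc (Suc n))) z\<bar> \<partial>lborel)"
        using Suc.IH[of "\<lambda>j. D (Suc j)" y] Suc.prems True by simp
      also have "\<dots> \<le> ennreal (h ^ n) * ?J"
        using True by (intro mult_left_mono nn_integral_mono) (auto simp: indicator_def algebra_simps)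
      finally show ?thesis using True by simp
    qed simp
  qed
  also have "\<dots> = ennreal (h ^ n) * ?J * ennreal h"
    using Suc.prems(3) by (subst nn_integral_cmult_indicator) auto
  also have "\<dots> = ennreal (h ^ Suc n) * ?J"
    using Suc.prems(3) by (simp add: ennreal_mult ac_simps)
  finally show ?case .
qed

text \<open>Up to order \<open>n\<close> the derivatives exist everywhere and are continuous, so the fundamental theorem of calculus
  applies; for the derivative of order \<open>n + 1\<close> absolute continuity takes its place.\<close>
lemma deriv_AC_primitive_chain:
  assumes f: "deriv_AC n f"
  obtains \<phi> :: "real \<Rightarrow> real" where "\<phi> \<in> borel_measurable borel"
    "AE x in lborel. x \<in> {0..1} \<longrightarrow> nth_deriv_within {0..1} (Suc n) f x = \<phi> x"
    "primitive_on_unit \<phi> (nth_deriv_within {0..1} n f)"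
    "\<And>j. j < n \<Longrightarrow> primitive_on_unit (nth_deriv_within {0..1} (Suc j) f) (nth_deriv_within {0..1} j f)"
proof -
  let ?d = "\<lambda>j. nth_deriv_within {0..1} j f"
  have AC: "absolutely_continuous_on {0..1} (?d n)"
    and diff: "\<And>j x. j < n \<Longrightarrow> x \<in> {0..1} \<Longrightarrow> ?d j differentiable (at x within {0..1})"
    using f unfolding deriv_AC_def by auto
  obtain \<phi> where \<phi>: "integrable lborel \<phi>"
    "\<And>x y. \<lbrakk>0 \<le> x; x \<le> y; y \<le> 1\<rbrakk> \<Longrightarrow> ?d n y - ?d n x = (LINT t:{x..y}|lborel. \<phi> t)"
    "AE x in lborel. x \<in> {0..1} \<longrightarrow> vector_derivative (?d n) (at x within {0..1}) = \<phi> x"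
    using absolutely_continuous_imp_indefinite_integral[OF AC] by blast
  have cont: "continuous_on {0..1} (?d j)" if "j \<le> n" for j
  proof (cases "j = n")
    case True
    then show ?thesis using absolutely_continuous_on_imp_continuous_on[OF AC] by simp
  next
    case False
    then have "?d j differentiable_on {0..1}" using that diff by (auto simp: differentiable_on_def)
    then show ?thesis by (rule differentiable_imp_continuous_on)
  qed
  have "primitive_on_unit (?d (Suc j)) (?d j)" if j: "j < n" for j
    unfolding primitive_on_unit_def
  proof (intro conjI allI impI)
    have c: "continuous_on {0..1} (?d (Suc j))" using j by (intro cont) simp
    show si: "set_integrable lborel {0..1} (?d (Suc j))"
      using borel_integrable_atLeastAtMost'[OF c] by simp
    fix x y :: real assume xy: "0 \<le> x" "x \<le> y" "y \<le> 1"
    have "(?d (Suc j) has_integral ?d j y - ?d j x) {x..y}"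
    proof (rule fundamental_theorem_of_calculus[OF xy(2)])
      fix z assume z: "z \<in> {x..y}"
      then have "?d j differentiable (at z within {0..1})" using diff j xy by auto
      then have "(?d j has_vector_derivative ?d (Suc j) z) (at z within {0..1})"
        by (simp add: vector_derivative_works)
      then show "(?d j has_vector_derivative ?d (Suc j) z) (at z within {x..y})"
        by (rule has_vector_derivative_within_subset) (use xy in auto)
    qed
    moreover have "set_integrable lborel {x..y} (?d (Suc j))"
      using xy by (intro set_integrable_subset[OF si]) auto
    ultimately show "?d j y - ?d j x = (LINT t:{x..y}|lborel. ?d (Suc j) t)"
      by (metis integral_unique set_borel_integral_eq_integral(2))
  qed
  moreover have "primitive_on_unit \<phi> (?d n)"
    using \<phi>(2) integrable_mult_indicator[OF _ \<phi>(1), of "{0..1}"]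
    by (simp add: primitive_on_unit_def set_integrable_def)
  moreover have "\<phi> \<in> borel_measurable borel"
    using \<phi>(1) borel_measurable_integrable by fastforce
  ultimately show ?thesis using \<phi>(3) that by simp
qed

section \<open>The \<open>L\<^sub>1\<close> norm against the \<open>L\<^sub>p\<close> quasi-norm and small differences\<close>

text \<open>The one-variable core of the local inequality. Here \<open>lam\<close> stands for \<open>\<bar>G(y)\<bar>\<close>, \<open>D t\<close> for
  \<open>\<bar>\<Delta>\<^sub>t\<^sup>m G(y)\<bar>\<close> and \<open>Q t\<close> for the sum of the other terms of the difference, whose integral is at most
  \<open>N * A\<close> by a change of variables. With \<open>\<epsilon> = 4 * N * A / lam\<close> the average of \<open>Q\<close> over \<open>(0, \<epsilon>)\<close> is at
  most \<open>lam / 4\<close>.\<close>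
lemma recover_from_small_steps:
  fixes p T A N lam :: real and D Q :: "real \<Rightarrow> real"
  assumes p: "0 < p" "p < 1" and T: "0 < T" and A: "0 < A" and N: "0 < N" and lam: "0 \<le> lam"
    and [measurable]: "D \<in> borel_measurable borel" "Q \<in> borel_measurable borel"
    and D0: "\<And>t. 0 \<le> D t" and Q0: "\<And>t. 0 \<le> Q t"
    and split: "\<And>t. \<lbrakk>0 < t; t < T\<rbrakk> \<Longrightarrow> lam \<le> D t + Q t"
    and Q: "(\<integral>\<^sup>+t\<in>{0<..<T}. ennreal (Q t) \<partial>lborel) \<le> ennreal (N * A)"
  shows "ennreal lam \<le> ennreal ((4 * N * A / T) powr (1 - p) * lam powr p)
     + ennreal (2 powr (p + 1) * (4 * N) powr (1 - p) * A powr (1 - p))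
       * (\<integral>\<^sup>+t\<in>{0<..<T}. ennreal (D t powr p * t powr (p - 2)) \<partial>lborel)"
proof (cases "lam \<le> 4 * N * A / T")
  case True
  have "lam = lam powr (1 - p) * lam powr p" using lam by (simp add: powr_add[symmetric])
  also have "\<dots> \<le> (4 * N * A / T) powr (1 - p) * lam powr p"
    using True lam p by (intro mult_right_mono powr_mono2) auto
  finally show ?thesis
    by (intro order_trans[OF ennreal_leI add_increasing2]) auto
next
  case False
  define \<epsilon> where "\<epsilon> = 4 * N * A / lam"
  have M: "0 < 4 * N * A / T" using A N T by simp
  then have lam0: "0 < lam" using False by linarith
  have eps0: "0 < \<epsilon>" using A N lam0 by (simp add: \<epsilon>_def)
  have epsT: "\<epsilon> \<le> T" using False T lam0 by (simp add: \<epsilon>_def field_simps)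
  define I where "I = (\<integral>\<^sup>+t\<in>{0<..<T}. ennreal (D t powr p * t powr (p - 2)) \<partial>lborel)"
  define J where "J = (\<integral>\<^sup>+t\<in>{0<..<\<epsilon>}. ennreal (D t powr p) \<partial>lborel)"
  define q where "q = (lam / 2) powr p"
  have q0: "0 < q" using lam0 by (simp add: q_def)
  \<comment> \<open>The Markov inequality in pointwise form: either \<open>D t \<ge> lam / 2\<close> or \<open>2 / lam * Q t \<ge> 1\<close>.\<close>
  have pw: "q \<le> D t powr p + q * (2 / lam) * Q t" if t: "0 < t" "t < \<epsilon>" for t
  proof (cases "Q t \<le> lam / 2")
    case True
    then have "lam / 2 \<le> D t" using split[of t] t epsT by simp
    then have "q \<le> D t powr p" unfolding q_def using lam0 p by (intro powr_mono2) auto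
    then show ?thesis using q0 Q0[of t] lam0 by (simp add: add_increasing2)
  next
    case False
    then have "1 \<le> (2 / lam) * Q t" using lam0 by (simp add: field_simps)
    then have "q * 1 \<le> q * ((2 / lam) * Q t)" using q0 by (intro mult_left_mono) auto
    then show ?thesis using D0[of t] by (simp add: add_increasing mult.assoc)
  qed
  have "ennreal (q * \<epsilon>) = (\<integral>\<^sup>+t\<in>{0<..<\<epsilon>}. ennreal q \<partial>lborel)"
    using eps0 q0 by (subst nn_integral_cmult_indicator) (auto simp: ennreal_mult)
  also have "\<dots> \<le> (\<integral>\<^sup>+t. ennreal (D t powr p) * indicator {0<..<\<epsilon>} t
      + ennreal (q * (2 / lam)) * (ennreal (Q t) * indicator {0<..<T} t) \<partial>lborel)"
  proof (intro nn_integral_mono)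
    fix t :: real
    have "ennreal q \<le> ennreal (D t powr p) + ennreal (q * (2 / lam)) * ennreal (Q t)" if "t \<in> {0<..<\<epsilon>}"
    proof -
      have "ennreal q \<le> ennreal (D t powr p + q * (2 / lam) * Q t)"
        using pw that by (intro ennreal_leI) auto
      also have "\<dots> = ennreal (D t powr p) + ennreal (q * (2 / lam) * Q t)"
        using q0 lam0 Q0[of t] by (intro ennreal_plus) auto
      also have "ennreal (q * (2 / lam) * Q t) = ennreal (q * (2 / lam)) * ennreal (Q t)"
        using q0 lam0 Q0[of t] by (intro ennreal_mult) auto
      finally show ?thesis .
    qed
    then show "ennreal q * indicator {0<..<\<epsilon>} t \<le> ennreal (D t powr p) * indicator {0<..<\<epsilon>} t
      + ennreal (q * (2 / lam)) * (ennreal (Q t) * indicator {0<..<T} t)"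
      using epsT by (auto simp: indicator_def)
  qed
  also have "\<dots> = J + ennreal (q * (2 / lam)) * (\<integral>\<^sup>+t\<in>{0<..<T}. ennreal (Q t) \<partial>lborel)"
    by (simp add: J_def nn_integral_add nn_integral_cmult)
  also have "\<dots> \<le> J + ennreal (q * (2 / lam)) * ennreal (N * A)"
    using Q by (intro add_left_mono mult_left_mono) auto
  also have "\<dots> = J + ennreal (q * \<epsilon> / 2)"
    using q0 lam0 A N by (simp add: ennreal_mult[symmetric] \<epsilon>_def)
  also have "ennreal (q * \<epsilon>) = ennreal (q * \<epsilon> / 2) + ennreal (q * \<epsilon> / 2)"
    using q0 eps0 by (subst ennreal_plus[symmetric]) auto
  finally have half: "ennreal (q * \<epsilon> / 2) \<le> J"
    by (simp add: ennreal_add_left_cancel_le add.commute)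
  have "J \<le> (\<integral>\<^sup>+t. ennreal (\<epsilon> powr (2 - p)) * (ennreal (D t powr p * t powr (p - 2)) * indicator {0<..<T} t) \<partial>lborel)"
    unfolding J_def
  proof (intro nn_integral_mono)
    fix t :: real
    have "D t powr p \<le> \<epsilon> powr (2 - p) * (D t powr p * t powr (p - 2))" if t: "t \<in> {0<..<\<epsilon>}"
    proof -
      have "1 = t powr (2 - p) * t powr (p - 2)" using t by (simp add: powr_add[symmetric])
      also have "\<dots> \<le> \<epsilon> powr (2 - p) * t powr (p - 2)"
        using t p by (intro mult_right_mono powr_mono2) auto
      finally have "D t powr p * 1 \<le> D t powr p * (\<epsilon> powr (2 - p) * t powr (p - 2))"
        by (intro mult_left_mono) auto
      then show ?thesis by (simp add: ac_simps)
    qed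
    then show "ennreal (D t powr p) * indicator {0<..<\<epsilon>} t
        \<le> ennreal (\<epsilon> powr (2 - p)) * (ennreal (D t powr p * t powr (p - 2)) * indicator {0<..<T} t)"
      using epsT by (auto simp: indicator_def ennreal_mult[symmetric] intro!: ennreal_leI)
  qed
  also have "\<dots> = ennreal (\<epsilon> powr (2 - p)) * I"
    by (simp add: I_def nn_integral_cmult)
  finally have JI: "J \<le> ennreal (\<epsilon> powr (2 - p)) * I" .
  define K where "K = 2 powr (p + 1) * (4 * N) powr (1 - p) * A powr (1 - p)"
  have lam_eq: "lam = K * \<epsilon> powr (p - 2) * (q * \<epsilon> / 2)"
  proof -
    have "\<epsilon> powr (p - 2) * \<epsilon> = \<epsilon> powr (p - 1)"
      using eps0 powr_mult_base[of \<epsilon> "p - 2"] by (simp add: mult.commute)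
    also have "\<dots> = (4 * N * A) powr (p - 1) * lam powr (1 - p)"
      using A N lam0 by (simp add: \<epsilon>_def powr_divide powr_minus_divide[of lam "1 - p", symmetric] field_simps
          powr_minus[of lam "p - 1", symmetric] powr_add[symmetric])
    finally have e: "\<epsilon> powr (p - 2) * \<epsilon> = (4 * N * A) powr (p - 1) * lam powr (1 - p)" .
    have K: "K = 2 powr (p + 1) * (4 * N * A) powr (1 - p)"
      using A N by (simp add: K_def powr_mult)
    have "K * \<epsilon> powr (p - 2) * (q * \<epsilon> / 2) = K * (\<epsilon> powr (p - 2) * \<epsilon>) * q / 2" by simp
    also have "\<dots> = 2 powr (p + 1) * ((4 * N * A) powr (1 - p) * (4 * N * A) powr (p - 1))
        * (lam powr (1 - p) * lam powr p) * (1 / 2) powr p / 2"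
      unfolding e K q_def using lam0 by (simp add: powr_mult powr_divide)
    also have "(4 * N * A) powr (1 - p) * (4 * N * A) powr (p - 1) = 1"
      using A N by (simp add: powr_add[symmetric])
    also have "lam powr (1 - p) * lam powr p = lam" using lam0 by (simp add: powr_add[symmetric])
    also have "2 powr (p + 1) * 1 * lam * (1 / 2) powr p / 2 = lam"
      by (simp add: powr_add powr_divide)
    finally show ?thesis by simp
  qed
  have "ennreal lam = ennreal (K * \<epsilon> powr (p - 2) * (q * \<epsilon> / 2))"
    by (rule arg_cong[OF lam_eq])
  also have "\<dots> = ennreal (K * \<epsilon> powr (p - 2)) * ennreal (q * \<epsilon> / 2)"
    using q0 eps0 by (intro ennreal_mult) (auto simp: K_def)
  also have "\<dots> \<le> ennreal (K * \<epsilon> powr (p - 2)) * (ennreal (\<epsilon> powr (2 - p)) * I)"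
    using half JI by (intro mult_left_mono) auto
  also have "\<dots> = ennreal (K * (\<epsilon> powr (p - 2) * \<epsilon> powr (2 - p))) * I"
    by (simp add: K_def ennreal_mult ac_simps)
  also have "\<epsilon> powr (p - 2) * \<epsilon> powr (2 - p) = 1" using eps0 by (simp add: powr_add[symmetric])
  finally have "ennreal lam \<le> ennreal K * I" by simp
  then show ?thesis unfolding K_def I_def by (rule add_increasing[rotated]) simp
qed

lemma nn_integral_affine_le:
  fixes F :: "real \<Rightarrow> ennreal"
  assumes [measurable]: "F \<in> borel_measurable borel" "U \<in> sets borel"
    and c: "1 \<le> \<bar>c\<bar>" and into: "\<And>t. t \<in> S \<Longrightarrow> y + c * t \<in> U"
  shows "(\<integral>\<^sup>+t\<in>S. F (y + c * t) \<partial>lborel) \<le> (\<integral>\<^sup>+z\<in>U. F z \<partial>lborel)"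
proof -
  have "(\<integral>\<^sup>+t\<in>S. F (y + c * t) \<partial>lborel) \<le> (\<integral>\<^sup>+t. F (y + c * t) * indicator U (y + c * t) \<partial>lborel)"
    using into by (intro nn_integral_mono) (auto simp: indicator_def)
  also have "\<dots> = 1 * (\<integral>\<^sup>+t. F (y + c * t) * indicator U (y + c * t) \<partial>lborel)" by simp
  also have "\<dots> \<le> ennreal \<bar>c\<bar> * (\<integral>\<^sup>+t. F (y + c * t) * indicator U (y + c * t) \<partial>lborel)"
    using c by (intro mult_right_mono) auto
  also have "\<dots> = (\<integral>\<^sup>+z\<in>U. F z \<partial>lborel)"
    using c by (subst nn_integral_real_affine[where c = c and t = y]) auto
  finally show ?thesis .
qed

text \<open>The shift \<open>s\<close> selects the kind of difference: \<open>s = 0\<close> gives forward differences at \<open>y\<close>, and \<open>s = m\<close> gives backward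
  ones. The indicators keep the difference inside \<open>[0,c]\<close>, where \<open>G\<close> is meaningful.\<close>
definition difference_energy ::
    "nat \<Rightarrow> real \<Rightarrow> real \<Rightarrow> real \<Rightarrow> real \<Rightarrow> (real \<Rightarrow> real) \<Rightarrow> real \<Rightarrow> ennreal" where
  "difference_energy m p T c s G y = (\<integral>\<^sup>+t\<in>{0<..<T}.
     ennreal (\<bar>finite_difference m t G (y - s * t)\<bar> powr p * t powr (p - 2))
       * indicator {0..} (y - s * t) * indicator {..c} (y - s * t + real m * t) \<partial>lborel)"

lemma borel_measurable_difference_energy [measurable]:
  assumes [measurable]: "G \<in> borel_measurable borel"
  shows "difference_energy m p T c s G \<in> borel_measurable borel"
  unfolding difference_energy_def[abs_def] by measurable

lemma sum_choose_real: "(\<Sum>i\<le>k. real (k choose i)) = 2 ^ k"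
  using choose_row_sum[of k] by (metis of_nat_numeral of_nat_power of_nat_sum)

lemma abs_le_forward_difference:
  "\<bar>G y\<bar> \<le> \<bar>finite_difference m t G y\<bar> + (\<Sum>i<m. real (m choose Suc i) * \<bar>G (y + real (Suc i) * t)\<bar>)"
proof -
  have "finite_difference m t G y = G y + (\<Sum>i<m. real (m choose Suc i) * (- 1) ^ Suc i * G (y + real (Suc i) * t))"
    unfolding finite_difference_def by (subst sum.atMost_shift) simp
  moreover have "\<bar>\<Sum>i<m. real (m choose Suc i) * (- 1) ^ Suc i * G (y + real (Suc i) * t)\<bar>
      \<le> (\<Sum>i<m. real (m choose Suc i) * \<bar>G (y + real (Suc i) * t)\<bar>)"
    by (rule order_trans[OF sum_abs]) (simp add: abs_mult power_abs)
  ultimately show ?thesis by linarith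
qed

lemma abs_le_backward_difference:
  "\<bar>G y\<bar> \<le> \<bar>finite_difference m t G (y - real m * t)\<bar>
     + (\<Sum>i<m. real (m choose i) * \<bar>G (y + (real i - real m) * t)\<bar>)"
proof -
  have "finite_difference m t G (y - real m * t)
      = (\<Sum>i<m. real (m choose i) * (- 1) ^ i * G (y + (real i - real m) * t)) + (- 1) ^ m * G y"
    unfolding finite_difference_def lessThan_Suc_atMost[symmetric] by (simp add: algebra_simps)
  moreover have "\<bar>\<Sum>i<m. real (m choose i) * (- 1) ^ i * G (y + (real i - real m) * t)\<bar>
      \<le> (\<Sum>i<m. real (m choose i) * \<bar>G (y + (real i - real m) * t)\<bar>)"
    by (rule order_trans[OF sum_abs]) (simp add: abs_mult power_abs)
  moreover have "\<bar>(- 1) ^ m * G y\<bar> = \<bar>G y\<bar>" by (simp add: abs_mult power_abs)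
  ultimately show ?thesis by linarith
qed

text \<open>The integral of \<open>\<bar>G (y + c i * t)\<bar>\<close> over \<open>t\<close> is \<open>1 / \<bar>c i\<bar> \<le> 1\<close> times an integral of \<open>\<bar>G\<bar>\<close> over a part
  of \<open>[a,b]\<close>.\<close>
lemma nn_integral_weighted_translates_le:
  fixes G :: "real \<Rightarrow> real"
  assumes [measurable]: "G \<in> borel_measurable borel"
    and c: "\<And>i. i \<in> J \<Longrightarrow> 1 \<le> \<bar>c i\<bar>" and w: "\<And>i. i \<in> J \<Longrightarrow> 0 \<le> w i"
    and into: "\<And>i t. i \<in> J \<Longrightarrow> t \<in> S \<Longrightarrow> y + c i * t \<in> {a..b}"
    and A: "(\<integral>\<^sup>+z\<in>{a..b}. ennreal \<bar>G z\<bar> \<partial>lborel) \<le> ennreal A" "0 \<le> A"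
    and S[measurable]: "S \<in> sets borel"
  shows "(\<integral>\<^sup>+t\<in>S. ennreal (\<Sum>i\<in>J. w i * \<bar>G (y + c i * t)\<bar>) \<partial>lborel) \<le> ennreal ((\<Sum>i\<in>J. w i) * A)"
proof -
  have "(\<integral>\<^sup>+t\<in>S. ennreal (\<Sum>i\<in>J. w i * \<bar>G (y + c i * t)\<bar>) \<partial>lborel)
      = (\<integral>\<^sup>+t. (\<Sum>i\<in>J. ennreal (w i) * (ennreal \<bar>G (y + c i * t)\<bar> * indicator S t)) \<partial>lborel)"
  proof (intro nn_integral_cong)
    fix t :: real
    have "ennreal (\<Sum>i\<in>J. w i * \<bar>G (y + c i * t)\<bar>) = (\<Sum>i\<in>J. ennreal (w i) * ennreal \<bar>G (y + c i * t)\<bar>)"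
      using w by (subst sum_ennreal[symmetric]) (auto simp: ennreal_mult intro!: sum.cong)
    then show "ennreal (\<Sum>i\<in>J. w i * \<bar>G (y + c i * t)\<bar>) * indicator S t
        = (\<Sum>i\<in>J. ennreal (w i) * (ennreal \<bar>G (y + c i * t)\<bar> * indicator S t))"
      by (simp add: sum_distrib_right mult.assoc)
  qed
  also have "\<dots> = (\<Sum>i\<in>J. ennreal (w i) * (\<integral>\<^sup>+t\<in>S. ennreal \<bar>G (y + c i * t)\<bar> \<partial>lborel))"
    by (subst nn_integral_sum) (auto simp: nn_integral_cmult)
  also have "\<dots> \<le> (\<Sum>i\<in>J. ennreal (w i) * ennreal A)"
    using c into A(1)
    by (intro sum_mono mult_left_mono order_trans[OF nn_integral_affine_le[where U = "{a..b}"] A(1)]) auto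
  also have "\<dots> = ennreal (\<Sum>i\<in>J. w i) * ennreal A"
    using w by (subst sum_distrib_right[symmetric]) (simp add: sum_ennreal)
  also have "\<dots> = ennreal ((\<Sum>i\<in>J. w i) * A)"
    using w A(2) by (intro ennreal_mult[symmetric] sum_nonneg) auto
  finally show ?thesis .
qed

text \<open>In the left half of \<open>[a,b]\<close> forward differences with steps below \<open>T\<close> stay inside, in the right half backward ones do.\<close>
lemma abs_le_Lp_and_energy:
  fixes G :: "real \<Rightarrow> real" and m :: nat and A :: real
  assumes p: "0 < p" "p < 1" and [measurable]: "G \<in> borel_measurable borel"
    and ab: "0 \<le> a" "b \<le> c" and T: "0 < T" "2 * real m * T \<le> b - a"
    and A: "0 < A" "(\<integral>\<^sup>+z\<in>{a..b}. ennreal \<bar>G z\<bar> \<partial>lborel) = ennreal A" and y: "y \<in> {a..b}"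
  shows "ennreal \<bar>G y\<bar> \<le> ennreal ((4 * 2^m * A / T) powr (1 - p) * \<bar>G y\<bar> powr p)
    + ennreal (2 powr (p + 1) * (4 * 2^m) powr (1 - p) * A powr (1 - p))
      * (difference_energy m p T c 0 G y + difference_energy m p T c m G y)"
proof (cases "2 * y \<le> a + b")
  case True
  have small: "y + real m * t \<le> b" if "t \<in> {0<..<T}" for t
  proof -
    have "real m * t \<le> real m * T" using that by (intro mult_left_mono) auto
    then show ?thesis using True T by linarith
  qed
  have le: "real (Suc i) * t \<le> real m * t" if "i < m" "t \<in> {0<..<T}" for i t
    using that by (intro mult_right_mono) auto
  have sum_le: "(\<Sum>i<m. real (m choose Suc i)) \<le> 2^m"
  proof -
    have "(\<Sum>i<m. real (m choose Suc i)) \<le> real (m choose 0) + (\<Sum>i<m. real (m choose Suc i))" by simp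
    also have "\<dots> = (\<Sum>i\<le>m. real (m choose i))" by (rule sum.atMost_shift[symmetric])
    also have "\<dots> = 2^m" by (rule sum_choose_real)
    finally show ?thesis .
  qed
  have "ennreal \<bar>G y\<bar> \<le> ennreal ((4 * 2^m * A / T) powr (1 - p) * \<bar>G y\<bar> powr p)
    + ennreal (2 powr (p + 1) * (4 * 2^m) powr (1 - p) * A powr (1 - p))
      * (\<integral>\<^sup>+t\<in>{0<..<T}. ennreal (\<bar>finite_difference m t G y\<bar> powr p * t powr (p - 2)) \<partial>lborel)"
  proof (rule recover_from_small_steps[where Q = "\<lambda>t. \<Sum>i<m. real (m choose Suc i) * \<bar>G (y + real (Suc i) * t)\<bar>"])
    have "(\<integral>\<^sup>+t\<in>{0<..<T}. ennreal (\<Sum>i<m. real (m choose Suc i) * \<bar>G (y + real (Suc i) * t)\<bar>) \<partial>lborel)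
        \<le> ennreal ((\<Sum>i<m. real (m choose Suc i)) * A)"
    proof (rule nn_integral_weighted_translates_le[where a = a and b = b])
      show "y + real (Suc i) * t \<in> {a..b}" if "i \<in> {..<m}" "t \<in> {0<..<T}" for i t
      proof -
        have "0 \<le> real (Suc i) * t" using that by simp
        moreover have "real (Suc i) * t \<le> real m * t" using le that by blast
        ultimately show ?thesis using small[OF that(2)] y unfolding atLeastAtMost_iff by linarith
      qed
    qed (use A in auto)
    also have "\<dots> \<le> ennreal (2^m * A)"
      using sum_le A by (intro ennreal_leI mult_right_mono) auto
    finally show "(\<integral>\<^sup>+t\<in>{0<..<T}. ennreal (\<Sum>i<m. real (m choose Suc i) * \<bar>G (y + real (Suc i) * t)\<bar>) \<partial>lborel)
        \<le> ennreal (2^m * A)" .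
  qed (use p T A abs_le_forward_difference in \<open>auto intro!: sum_nonneg\<close>)
  also have "(\<integral>\<^sup>+t\<in>{0<..<T}. ennreal (\<bar>finite_difference m t G y\<bar> powr p * t powr (p - 2)) \<partial>lborel)
      = difference_energy m p T c 0 G y"
    unfolding difference_energy_def using small ab y by (intro nn_integral_cong) (fastforce simp: indicator_def)
  also have "\<dots> \<le> difference_energy m p T c 0 G y + difference_energy m p T c m G y" by simp
  finally show ?thesis by (simp add: mult_left_mono add_left_mono)
next
  case False
  have small: "a \<le> y - real m * t" if "t \<in> {0<..<T}" for t
  proof -
    have "real m * t \<le> real m * T" using that by (intro mult_left_mono) auto
    then show ?thesis using False T by linarith
  qed
  have sum_le: "(\<Sum>i<m. real (m choose i)) \<le> 2^m"
  proof -
    have "(\<Sum>i<m. real (m choose i)) \<le> (\<Sum>i\<le>m. real (m choose i))" by (intro sum_mono2) auto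
    also have "\<dots> = 2^m" by (rule sum_choose_real)
    finally show ?thesis .
  qed
  have "ennreal \<bar>G y\<bar> \<le> ennreal ((4 * 2^m * A / T) powr (1 - p) * \<bar>G y\<bar> powr p)
    + ennreal (2 powr (p + 1) * (4 * 2^m) powr (1 - p) * A powr (1 - p))
      * (\<integral>\<^sup>+t\<in>{0<..<T}. ennreal (\<bar>finite_difference m t G (y - real m * t)\<bar> powr p * t powr (p - 2)) \<partial>lborel)"
  proof (rule recover_from_small_steps[where Q = "\<lambda>t. \<Sum>i<m. real (m choose i) * \<bar>G (y + (real i - real m) * t)\<bar>"])
    have "(\<integral>\<^sup>+t\<in>{0<..<T}. ennreal (\<Sum>i<m. real (m choose i) * \<bar>G (y + (real i - real m) * t)\<bar>) \<partial>lborel)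
        \<le> ennreal ((\<Sum>i<m. real (m choose i)) * A)"
    proof (rule nn_integral_weighted_translates_le[where a = a and b = b])
      show "y + (real i - real m) * t \<in> {a..b}" if "i \<in> {..<m}" "t \<in> {0<..<T}" for i t
      proof -
        have "0 \<le> real i * t" "real i * t \<le> real m * t" using that by (auto intro!: mult_right_mono)
        then show ?thesis using small[OF that(2)] y by (simp add: left_diff_distrib)
      qed
    qed (use A in auto)
    also have "\<dots> \<le> ennreal (2^m * A)"
      using sum_le A by (intro ennreal_leI mult_right_mono) auto
    finally show "(\<integral>\<^sup>+t\<in>{0<..<T}. ennreal (\<Sum>i<m. real (m choose i) * \<bar>G (y + (real i - real m) * t)\<bar>) \<partial>lborel)
        \<le> ennreal (2^m * A)" .
  qed (use p T A abs_le_backward_difference in \<open>auto intro!: sum_nonneg\<close>)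
  also have "(\<integral>\<^sup>+t\<in>{0<..<T}. ennreal (\<bar>finite_difference m t G (y - real m * t)\<bar> powr p * t powr (p - 2)) \<partial>lborel)
      = difference_energy m p T c m G y"
    unfolding difference_energy_def using small ab y by (intro nn_integral_cong) (fastforce simp: indicator_def)
  also have "\<dots> \<le> difference_energy m p T c 0 G y + difference_energy m p T c m G y" by simp
  finally show ?thesis by (simp add: mult_left_mono add_left_mono)
qed

text \<open>Integrate \<open>abs_le_Lp_and_energy\<close> over \<open>[a,b]\<close>: both terms on the right contain the factor
  \<open>A powr (1 - p)\<close>, and dividing by it leaves \<open>A powr p\<close>.\<close>
lemma L1_le_Lp_and_energy:
  fixes G :: "real \<Rightarrow> real" and m :: nat and A :: real
  assumes p: "0 < p" "p < 1" and [measurable]: "G \<in> borel_measurable borel"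
    and ab: "0 \<le> a" "b \<le> c" and T: "0 < T" "2 * real m * T \<le> b - a"
    and A: "0 \<le> A" "(\<integral>\<^sup>+z\<in>{a..b}. ennreal \<bar>G z\<bar> \<partial>lborel) = ennreal A"
  shows "ennreal (A powr p) \<le> (\<integral>\<^sup>+y\<in>{a..b}. ennreal ((4 * 2^m / T) powr (1 - p)) * ennreal (\<bar>G y\<bar> powr p)
    + ennreal (2 powr (p + 1) * (4 * 2^m) powr (1 - p))
      * (difference_energy m p T c 0 G y + difference_energy m p T c m G y) \<partial>lborel)"
proof (cases "A = 0")
  case False
  then have A0: "0 < A" using A by simp
  let ?W = "\<lambda>y. ennreal ((4 * 2^m / T) powr (1 - p)) * ennreal (\<bar>G y\<bar> powr p)
    + ennreal (2 powr (p + 1) * (4 * 2^m) powr (1 - p))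
      * (difference_energy m p T c 0 G y + difference_energy m p T c m G y)"
  have "ennreal A = (\<integral>\<^sup>+y\<in>{a..b}. ennreal \<bar>G y\<bar> \<partial>lborel)" using A by simp
  also have "\<dots> \<le> (\<integral>\<^sup>+y\<in>{a..b}. ennreal (A powr (1 - p)) * ?W y \<partial>lborel)"
  proof (intro nn_integral_mono)
    fix y
    have "ennreal \<bar>G y\<bar> \<le> ennreal (A powr (1 - p)) * ?W y" if "y \<in> {a..b}"
    proof -
      have 1: "(4 * 2^m * A / T) powr (1 - p) = (4 * 2^m / T) powr (1 - p) * A powr (1 - p)"
        using A0 T by (simp add: powr_mult[symmetric])
      show ?thesis
        using abs_le_Lp_and_energy[OF p \<open>G \<in> borel_measurable borel\<close> ab T A0 A(2) that]
        unfolding 1 by (simp add: ennreal_mult distrib_left ac_simps)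
    qed
    then show "ennreal \<bar>G y\<bar> * indicator {a..b} y \<le> ennreal (A powr (1 - p)) * ?W y * indicator {a..b} y"
      by (auto simp: indicator_def)
  qed
  also have "\<dots> = ennreal (A powr (1 - p)) * (\<integral>\<^sup>+y\<in>{a..b}. ?W y \<partial>lborel)"
    by (simp add: mult.assoc nn_integral_cmult)
  finally have "ennreal (A powr (p - 1)) * ennreal A
      \<le> ennreal (A powr (p - 1)) * (ennreal (A powr (1 - p)) * (\<integral>\<^sup>+y\<in>{a..b}. ?W y \<partial>lborel))"
    by (intro mult_left_mono) auto
  moreover have "ennreal (A powr (p - 1)) * ennreal A = ennreal (A powr p)"
    using A0 powr_mult_base[of A "p - 1"] by (simp add: mult.commute flip: ennreal_mult)
  moreover have "ennreal (A powr (p - 1)) * ennreal (A powr (1 - p)) = 1"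
    using A0 by (simp add: powr_add[symmetric] flip: ennreal_mult)
  ultimately show ?thesis by (simp add: mult.assoc[symmetric])
qed (use p in auto)

lemma powr_add_le:
  fixes a b p :: real
  assumes "0 \<le> a" "0 \<le> b" "0 < p" "p \<le> 1"
  shows "(a + b) powr p \<le> a powr p + b powr p"
proof (cases "a + b = 0")
  case False
  then have s: "0 < a + b" using assms by linarith
  have *: "x / (a + b) \<le> (x / (a + b)) powr p" if "0 \<le> x" "x \<le> a + b" for x
    using powr_mono'[of p 1 "x / (a + b)"] that assms s by (simp add: field_simps)
  have "1 = a / (a + b) + b / (a + b)" using s by (simp add: add_divide_distrib[symmetric])
  also have "\<dots> \<le> (a / (a + b)) powr p + (b / (a + b)) powr p"
    using * assms by (intro add_mono) auto
  also have "\<dots> = (a powr p + b powr p) / (a + b) powr p"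
    using assms by (simp add: powr_divide add_divide_distrib)
  finally show ?thesis using s by (simp add: field_simps)
qed (use assms in auto)

lemma powr_sum_le:
  fixes f :: "'i \<Rightarrow> real"
  assumes "finite J" "\<And>i. i \<in> J \<Longrightarrow> 0 \<le> f i" "0 < p" "p \<le> 1"
  shows "(\<Sum>i\<in>J. f i) powr p \<le> (\<Sum>i\<in>J. f i powr p)"
  using assms(1,2)
proof (induction J rule: finite_induct)
  case (insert i J)
  then have "(f i + (\<Sum>i\<in>J. f i)) powr p \<le> f i powr p + (\<Sum>i\<in>J. f i) powr p"
    using assms by (intro powr_add_le sum_nonneg) auto
  then show ?case using insert by (simp add: order_trans)
qed auto

section \<open>Integration over moving windows\<close>

text \<open>\<open>\<Delta>\<^sub>t\<^sup>m \<Delta>\<^sub>h\<^sup>k g\<close> is a combination of \<open>k + 1\<close> translates of \<open>\<Delta>\<^sub>t\<^sup>m g\<close>, and the \<open>p\<close>-th power is subadditive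
  for \<open>p \<le> 1\<close>. The binomial coefficients, being at least 1, do not increase when raised to the power \<open>p\<close>, so
  their sum \<open>2\<^sup>k\<close> serves as the constant.\<close>
lemma nn_integral_difference_of_difference_le:
  fixes g :: "real \<Rightarrow> real"
  assumes p: "0 < p" "p \<le> 1" and [measurable]: "g \<in> borel_measurable borel" and h: "0 \<le> h"
  shows "(\<integral>\<^sup>+z\<in>{0..1 - real k * h - real m * t}.
        ennreal (\<bar>finite_difference m t (finite_difference k h g) z\<bar> powr p) \<partial>lborel)
     \<le> ennreal (2 ^ k) * (\<integral>\<^sup>+z\<in>{0..1 - real m * t}. ennreal (\<bar>finite_difference m t g z\<bar> powr p) \<partial>lborel)"
    (is "?L \<le> _ * ?N")
proof -
  let ?S = "{0..1 - real k * h - real m * t}"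
  have pt: "ennreal (\<bar>finite_difference m t (finite_difference k h g) z\<bar> powr p)
      \<le> (\<Sum>\<nu>\<le>k. ennreal (real (k choose \<nu>)) * ennreal (\<bar>finite_difference m t g (real \<nu> * h + 1 * z)\<bar> powr p))" for z
  proof -
    let ?d = "\<lambda>\<nu>. \<bar>finite_difference m t g (z + real \<nu> * h)\<bar>"
    have "\<bar>finite_difference m t (finite_difference k h g) z\<bar> powr p \<le> (\<Sum>\<nu>\<le>k. real (k choose \<nu>) * ?d \<nu>) powr p"
      unfolding finite_difference_commute using p
      by (intro powr_mono2 order_trans[OF sum_abs]) (auto simp: abs_mult power_abs)
    also have "\<dots> \<le> (\<Sum>\<nu>\<le>k. (real (k choose \<nu>) * ?d \<nu>) powr p)"
      using p by (intro powr_sum_le) auto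
    also have "\<dots> \<le> (\<Sum>\<nu>\<le>k. real (k choose \<nu>) * ?d \<nu> powr p)"
    proof (intro sum_mono)
      fix \<nu> assume "\<nu> \<in> {..k}"
      then have "1 \<le> real (k choose \<nu>)" by (simp add: Suc_leI)
      then have "real (k choose \<nu>) powr p \<le> real (k choose \<nu>) powr 1" using p by (intro powr_mono) auto
      then show "(real (k choose \<nu>) * ?d \<nu>) powr p \<le> real (k choose \<nu>) * ?d \<nu> powr p"
        by (simp add: powr_mult mult_right_mono)
    qed
    finally have "ennreal (\<bar>finite_difference m t (finite_difference k h g) z\<bar> powr p)
        \<le> ennreal (\<Sum>\<nu>\<le>k. real (k choose \<nu>) * ?d \<nu> powr p)" by (rule ennreal_leI)
    also have "\<dots> = (\<Sum>\<nu>\<le>k. ennreal (real (k choose \<nu>) * ?d \<nu> powr p))"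
      by (intro sum_ennreal[symmetric]) auto
    finally show ?thesis by (simp add: ennreal_mult add.commute)
  qed
  have "?L \<le> (\<integral>\<^sup>+z. (\<Sum>\<nu>\<le>k. ennreal (real (k choose \<nu>)) *
      (ennreal (\<bar>finite_difference m t g (real \<nu> * h + 1 * z)\<bar> powr p) * indicator ?S z)) \<partial>lborel)"
    using pt by (intro nn_integral_mono) (auto simp: indicator_def)
  also have "\<dots> = (\<Sum>\<nu>\<le>k. ennreal (real (k choose \<nu>)) *
      (\<integral>\<^sup>+z\<in>?S. ennreal (\<bar>finite_difference m t g (real \<nu> * h + 1 * z)\<bar> powr p) \<partial>lborel))"
    by (subst nn_integral_sum) (auto simp: nn_integral_cmult)
  also have "\<dots> \<le> (\<Sum>\<nu>\<le>k. ennreal (real (k choose \<nu>)) * ?N)"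
  proof (intro sum_mono mult_left_mono nn_integral_affine_le)
    fix \<nu> z assume "\<nu> \<in> {..k}" "z \<in> ?S"
    moreover from this have "0 \<le> real \<nu> * h" "real \<nu> * h \<le> real k * h"
      using h by (auto intro!: mult_right_mono)
    ultimately show "real \<nu> * h + 1 * z \<in> {0..1 - real m * t}" by auto
  qed auto
  also have "\<dots> = ennreal (2 ^ k) * ?N"
    by (subst sum_distrib_right[symmetric]) (simp add: sum_choose_real)
  finally show ?thesis .
qed

definition smoothness_integral :: "nat \<Rightarrow> real \<Rightarrow> real \<Rightarrow> (real \<Rightarrow> real) \<Rightarrow> ennreal" where
  "smoothness_integral m p T g = (\<integral>\<^sup>+t\<in>{0<..<T}. ennreal (t powr (p - 2)) *
     (\<integral>\<^sup>+z\<in>{0..1 - real m * t}. ennreal (\<bar>finite_difference m t g z\<bar> powr p) \<partial>lborel) \<partial>lborel)"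

text \<open>After exchanging the integrals over \<open>y\<close> and \<open>t\<close>, the substitution \<open>z = y - s * t\<close> makes the bound independent
  of the shift.\<close>
lemma nn_integral_difference_energy_le:
  fixes g :: "real \<Rightarrow> real"
  assumes p: "0 < p" "p \<le> 1" and g[measurable]: "g \<in> borel_measurable borel" and h: "0 \<le> h"
  shows "(\<integral>\<^sup>+y\<in>{0..1 - real k * h}. difference_energy m p T (1 - real k * h) s (finite_difference k h g) y \<partial>lborel)
     \<le> ennreal (2 ^ k) * smoothness_integral m p T g"
proof -
  let ?c = "1 - real k * h" and ?G = "finite_difference k h g"
  let ?f = "\<lambda>t y. ennreal (\<bar>finite_difference m t ?G y\<bar> powr p)"
  have "(\<integral>\<^sup>+y\<in>{0..?c}. difference_energy m p T ?c s ?G y \<partial>lborel)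
      = (\<integral>\<^sup>+y. \<integral>\<^sup>+t. ennreal (t powr (p - 2)) * indicator {0<..<T} t
          * (?f t (y - s * t) * indicator {0..?c} y * indicator {0..} (y - s * t) * indicator {..?c} (y - s * t + real m * t)) \<partial>lborel \<partial>lborel)"
    unfolding difference_energy_def
    by (subst nn_integral_multc[symmetric]) (auto simp: ennreal_mult ac_simps intro!: nn_integral_cong)
  also have "\<dots> = (\<integral>\<^sup>+t. \<integral>\<^sup>+y. ennreal (t powr (p - 2)) * indicator {0<..<T} t
          * (?f t (y - s * t) * indicator {0..?c} y * indicator {0..} (y - s * t) * indicator {..?c} (y - s * t + real m * t)) \<partial>lborel \<partial>lborel)"
    by (rule lborel_pair.Fubini') measurable
  also have "\<dots> = (\<integral>\<^sup>+t. ennreal (t powr (p - 2)) * indicator {0<..<T} t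
          * (\<integral>\<^sup>+y. ?f t (y - s * t) * indicator {0..?c} y * indicator {0..} (y - s * t) * indicator {..?c} (y - s * t + real m * t) \<partial>lborel) \<partial>lborel)"
    by (subst nn_integral_cmult) auto
  also have "\<dots> \<le> (\<integral>\<^sup>+t. ennreal (t powr (p - 2)) * indicator {0<..<T} t
          * (ennreal (2 ^ k) * (\<integral>\<^sup>+z\<in>{0..1 - real m * t}. ennreal (\<bar>finite_difference m t g z\<bar> powr p) \<partial>lborel)) \<partial>lborel)"
  proof (intro nn_integral_mono mult_left_mono)
    fix t :: real
    have "(\<integral>\<^sup>+y. ?f t (y - s * t) * indicator {0..?c} y * indicator {0..} (y - s * t) * indicator {..?c} (y - s * t + real m * t) \<partial>lborel)
        \<le> (\<integral>\<^sup>+y\<in>{y. y - s * t \<in> {0..?c - real m * t}}. ?f t (- (s * t) + 1 * y) \<partial>lborel)"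
      by (intro nn_integral_mono) (auto simp: indicator_def)
    also have "\<dots> \<le> (\<integral>\<^sup>+z\<in>{0..1 - real k * h - real m * t}. ?f t z \<partial>lborel)"
      by (intro nn_integral_affine_le) auto
    also have "\<dots> \<le> ennreal (2 ^ k) * (\<integral>\<^sup>+z\<in>{0..1 - real m * t}. ennreal (\<bar>finite_difference m t g z\<bar> powr p) \<partial>lborel)"
      by (rule nn_integral_difference_of_difference_le[OF p g h])
    finally show "(\<integral>\<^sup>+y. ?f t (y - s * t) * indicator {0..?c} y * indicator {0..} (y - s * t) * indicator {..?c} (y - s * t + real m * t) \<partial>lborel)
        \<le> ennreal (2 ^ k) * (\<integral>\<^sup>+z\<in>{0..1 - real m * t}. ennreal (\<bar>finite_difference m t g z\<bar> powr p) \<partial>lborel)" .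
  qed simp
  also have "\<dots> = ennreal (2 ^ k) * smoothness_integral m p T g"
    unfolding smoothness_integral_def
    by (subst nn_integral_cmult[symmetric]) (auto simp: ac_simps indicator_def intro!: nn_integral_cong)
  finally show ?thesis .
qed

text \<open>Each point \<open>y\<close> lies in the window \<open>[x, x + l]\<close> only for a set of \<open>x\<close> of measure at most \<open>l\<close>.\<close>
lemma nn_integral_window_le:
  fixes W :: "real \<Rightarrow> ennreal"
  assumes [measurable]: "W \<in> borel_measurable borel" and l: "0 \<le> l"
  shows "(\<integral>\<^sup>+x\<in>{0..u}. (\<integral>\<^sup>+y\<in>{x..x + l}. W y \<partial>lborel) \<partial>lborel) \<le> ennreal l * (\<integral>\<^sup>+y\<in>{0..u + l}. W y \<partial>lborel)"
proof -
  have "(\<integral>\<^sup>+x\<in>{0..u}. (\<integral>\<^sup>+y\<in>{x..x + l}. W y \<partial>lborel) \<partial>lborel)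
      = (\<integral>\<^sup>+x. \<integral>\<^sup>+y. W y * (indicator {0..} (y - x) * indicator {..l} (y - x) * indicator {0..u} x) \<partial>lborel \<partial>lborel)"
    by (subst nn_integral_multc[symmetric]) (auto simp: indicator_def intro!: nn_integral_cong)
  also have "\<dots> = (\<integral>\<^sup>+y. \<integral>\<^sup>+x. W y * (indicator {0..} (y - x) * indicator {..l} (y - x) * indicator {0..u} x) \<partial>lborel \<partial>lborel)"
    by (rule lborel_pair.Fubini') measurable
  also have "\<dots> \<le> (\<integral>\<^sup>+y. \<integral>\<^sup>+x. W y * indicator {0..u + l} y * indicator {y - l..y} x \<partial>lborel \<partial>lborel)"
    by (intro nn_integral_mono) (auto simp: indicator_def)
  also have "\<dots> = (\<integral>\<^sup>+y. W y * indicator {0..u + l} y * ennreal l \<partial>lborel)"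
    using l by (subst nn_integral_cmult) auto
  also have "\<dots> = ennreal l * (\<integral>\<^sup>+y\<in>{0..u + l}. W y \<partial>lborel)"
    by (subst nn_integral_cmult[symmetric]) (auto simp: ac_simps)
  finally show ?thesis .
qed

text \<open>The estimate for one step \<open>h\<close> in terms of \<open>p\<close>-th powers combines three facts: the pointwise bound by the
  \<open>L\<^sub>1\<close> norm of \<open>\<Delta>\<^sub>h\<^sup>k g\<close> over the window \<open>[x, x + (n + 1) h]\<close>, the local inequality on this window, and the bound
  for integrals over moving windows.\<close>
lemma Lp_power_difference_le:
  fixes p h :: real and D :: "nat \<Rightarrow> real \<Rightarrow> real" and n k m :: nat
  defines "g \<equiv> D (Suc n)"
  assumes p: "0 < p" "p < 1" and m: "1 \<le> m" and g[measurable]: "g \<in> borel_measurable borel"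
    and D: "\<And>j. j \<le> n \<Longrightarrow> primitive_on_unit (D (Suc j)) (D j)"
    and h: "0 < h" "real (k + Suc n) * h \<le> 1"
  shows "(\<integral>\<^sup>+x\<in>{0..1 - real (k + Suc n) * h}. ennreal (\<bar>finite_difference (k + Suc n) h (D 0) x\<bar> powr p) \<partial>lborel)
    \<le> ennreal (real (Suc n) * (8 * m * 2 ^ m) powr (1 - p) * h powr (real (Suc n) * p))
        * (\<integral>\<^sup>+y\<in>{0..1 - real k * h}. ennreal (\<bar>finite_difference k h g y\<bar> powr p) \<partial>lborel)
      + ennreal (real (Suc n) * 2 powr (p + 1) * (4 * 2 ^ m) powr (1 - p) * 2 ^ Suc k * h powr (real (Suc n) * p - p + 1))
        * smoothness_integral m p h g"
proof -
  let ?r = "Suc n"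
  let ?c = "1 - real k * h" and ?G = "finite_difference k h g"
  let ?l = "real ?r * h" and ?u = "1 - real (k + Suc n) * h"
  \<comment> \<open>With this choice \<open>m\<close> steps of size at most \<open>T\<close> fit into half of a window of length at least \<open>h\<close>.\<close>
  define T where "T = h / (2 * real m)"
  have T: "0 < T" "2 * real m * T = h" "T \<le> h" using h m by (auto simp: T_def field_simps)
  define \<kappa> where "\<kappa> = (4 * 2^m / T) powr (1 - p)"
  define K where "K = 2 powr (p + 1) * (4 * 2^m :: real) powr (1 - p)"
  define W where "W y = ennreal \<kappa> * ennreal (\<bar>?G y\<bar> powr p)
      + ennreal K * (difference_energy m p T ?c 0 ?G y + difference_energy m p T ?c m ?G y)" for y
  have G[measurable]: "?G \<in> borel_measurable borel" by measurable
  have W[measurable]: "W \<in> borel_measurable borel" unfolding W_def[abs_def] by measurable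
  have ul: "?u + ?l = ?c" by (simp add: algebra_simps)
  define H where "H = (\<integral>\<^sup>+z\<in>{0..1}. ennreal \<bar>g z\<bar> \<partial>lborel)"
  have "integrable lborel (\<lambda>z. indicator {0..1} z * g z)"
    using D[of n] by (simp add: primitive_on_unit_def set_integrable_def g_def)
  then have "(\<integral>\<^sup>+z. ennreal (norm (indicator {0..1} z * g z)) \<partial>lborel) < \<infinity>"
    by (simp add: integrable_iff_bounded)
  also have "(\<integral>\<^sup>+z. ennreal (norm (indicator {0..1} z * g z)) \<partial>lborel) = H"
    unfolding H_def by (intro nn_integral_cong) (auto simp: indicator_def)
  finally have H: "H < \<infinity>" .
  have pt: "ennreal (\<bar>finite_difference (k + ?r) h (D 0) x\<bar> powr p)
      \<le> ennreal (h powr (real n * p)) * (\<integral>\<^sup>+y\<in>{x..x + ?l}. W y \<partial>lborel)" if x: "x \<in> {0..?u}" for x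
  proof -
    have xl: "x + ?l \<le> ?c" using x ul by auto
    have "(\<integral>\<^sup>+z\<in>{x..x + ?l}. ennreal \<bar>?G z\<bar> \<partial>lborel)
        \<le> (\<integral>\<^sup>+z\<in>{x..x + ?l}. ennreal (\<Sum>\<nu>\<le>k. real (k choose \<nu>) * \<bar>g (real \<nu> * h + 1 * z)\<bar>) \<partial>lborel)"
      using abs_finite_difference_le[of k h g]
      by (intro nn_integral_mono mult_right_mono ennreal_leI) (auto simp: add.commute)
    also have "\<dots> = (\<integral>\<^sup>+z. (\<Sum>\<nu>\<le>k. ennreal (real (k choose \<nu>)) *
        (ennreal \<bar>g (real \<nu> * h + 1 * z)\<bar> * indicator {x..x + ?l} z)) \<partial>lborel)"
      by (intro nn_integral_cong)
        (simp add: sum_distrib_right mult.assoc ennreal_mult flip: sum_ennreal)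
    also have "\<dots> = (\<Sum>\<nu>\<le>k. ennreal (real (k choose \<nu>)) *
        (\<integral>\<^sup>+z\<in>{x..x + ?l}. ennreal \<bar>g (real \<nu> * h + 1 * z)\<bar> \<partial>lborel))"
      by (subst nn_integral_sum) (auto simp: nn_integral_cmult)
    also have "\<dots> \<le> (\<Sum>\<nu>\<le>k. ennreal (real (k choose \<nu>)) * H)"
      unfolding H_def
    proof (intro sum_mono mult_left_mono nn_integral_affine_le)
      fix \<nu> z assume "\<nu> \<in> {..k}" "z \<in> {x..x + ?l}"
      moreover from this have "0 \<le> real \<nu> * h" "real \<nu> * h \<le> real k * h"
        using h by (auto intro!: mult_right_mono)
      ultimately show "real \<nu> * h + 1 * z \<in> {0..1}" using x xl by auto
    qed auto
    also have "\<dots> < \<infinity>" using H by (simp add: ennreal_mult_less_top)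
    finally obtain A where A: "0 \<le> A" "(\<integral>\<^sup>+z\<in>{x..x + ?l}. ennreal \<bar>?G z\<bar> \<partial>lborel) = ennreal A"
      by (auto simp: less_top[symmetric] elim: ennreal_cases)
    have "ennreal \<bar>finite_difference (k + ?r) h (D 0) x\<bar> \<le> ennreal (h ^ n) * ennreal A"
      using finite_difference_le_iterated[of n D x h k] D x h A unfolding g_def by simp
    then have "\<bar>finite_difference (k + ?r) h (D 0) x\<bar> \<le> h ^ n * A"
      using h A by (simp flip: ennreal_mult)
    then have "\<bar>finite_difference (k + ?r) h (D 0) x\<bar> powr p \<le> (h ^ n * A) powr p"
      using p by (intro powr_mono2) auto
    also have "\<dots> = h powr (real n * p) * A powr p"
      using h by (simp add: powr_mult powr_realpow[symmetric] powr_powr)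
    finally have "ennreal (\<bar>finite_difference (k + ?r) h (D 0) x\<bar> powr p)
        \<le> ennreal (h powr (real n * p)) * ennreal (A powr p)"
      by (simp add: ennreal_leI flip: ennreal_mult)
    also have "ennreal (A powr p) \<le> (\<integral>\<^sup>+y\<in>{x..x + ?l}. W y \<partial>lborel)"
      unfolding W_def \<kappa>_def K_def
    proof (rule L1_le_Lp_and_energy[OF p G _ xl T(1) _ A])
      show "2 * real m * T \<le> x + ?l - x" unfolding T(2) using h by (simp add: algebra_simps)
    qed (use x in auto)
    finally show ?thesis by (simp add: mult_left_mono)
  qed
  have energy: "(\<integral>\<^sup>+y\<in>{0..?c}. W y \<partial>lborel)
      \<le> ennreal \<kappa> * (\<integral>\<^sup>+y\<in>{0..?c}. ennreal (\<bar>?G y\<bar> powr p) \<partial>lborel) + ennreal (K * 2 ^ Suc k) * smoothness_integral m p h g"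
  proof -
    have mono: "smoothness_integral m p T g \<le> smoothness_integral m p h g"
      unfolding smoothness_integral_def using T by (intro nn_integral_mono) (auto simp: indicator_def)
    have "(\<integral>\<^sup>+y\<in>{0..?c}. W y \<partial>lborel) = ennreal \<kappa> * (\<integral>\<^sup>+y\<in>{0..?c}. ennreal (\<bar>?G y\<bar> powr p) \<partial>lborel)
        + ennreal K * ((\<integral>\<^sup>+y\<in>{0..?c}. difference_energy m p T ?c 0 ?G y \<partial>lborel)
          + (\<integral>\<^sup>+y\<in>{0..?c}. difference_energy m p T ?c m ?G y \<partial>lborel))"
      unfolding W_def by (simp add: distrib_right mult.assoc nn_integral_add nn_integral_cmult)
    also have "\<dots> \<le> ennreal \<kappa> * (\<integral>\<^sup>+y\<in>{0..?c}. ennreal (\<bar>?G y\<bar> powr p) \<partial>lborel)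
        + ennreal K * (ennreal (2 ^ k) * smoothness_integral m p h g + ennreal (2 ^ k) * smoothness_integral m p h g)"
      using p h
      by (intro add_left_mono mult_left_mono add_mono
          order_trans[OF nn_integral_difference_energy_le mult_left_mono[OF mono]]) auto
    also have "ennreal K * (ennreal (2 ^ k) * smoothness_integral m p h g + ennreal (2 ^ k) * smoothness_integral m p h g)
        = ennreal (K * 2 ^ Suc k) * smoothness_integral m p h g"
    proof -
      have "ennreal (2 ^ k) + ennreal (2 ^ k) = ennreal (2 ^ Suc k)"
        by (subst ennreal_plus[symmetric]) auto
      then show ?thesis by (simp add: K_def ennreal_mult mult.assoc flip: distrib_right)
    qed
    finally show ?thesis .
  qed
  have "(\<integral>\<^sup>+x\<in>{0..?u}. ennreal (\<bar>finite_difference (k + ?r) h (D 0) x\<bar> powr p) \<partial>lborel)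
      \<le> (\<integral>\<^sup>+x\<in>{0..?u}. ennreal (h powr (real n * p)) * (\<integral>\<^sup>+y\<in>{x..x + ?l}. W y \<partial>lborel) \<partial>lborel)"
    using pt by (intro nn_integral_mono) (auto simp: indicator_def)
  also have "\<dots> = ennreal (h powr (real n * p)) * (\<integral>\<^sup>+x\<in>{0..?u}. (\<integral>\<^sup>+y\<in>{x..x + ?l}. W y \<partial>lborel) \<partial>lborel)"
    by (subst nn_integral_cmult[symmetric]) (auto simp: mult.assoc indicator_def)
  also have "\<dots> \<le> ennreal (h powr (real n * p)) * (ennreal ?l * (\<integral>\<^sup>+y\<in>{0..?c}. W y \<partial>lborel))"
    using nn_integral_window_le[OF W, of ?l ?u] h unfolding ul by (intro mult_left_mono) auto
  also have "\<dots> \<le> ennreal (h powr (real n * p)) * (ennreal ?l * (ennreal \<kappa> * (\<integral>\<^sup>+y\<in>{0..?c}. ennreal (\<bar>?G y\<bar> powr p) \<partial>lborel) + ennreal (K * 2 ^ Suc k) * smoothness_integral m p h g))"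
    by (intro mult_left_mono energy) auto
  also have "\<dots> = ennreal (h powr (real n * p) * ?l * \<kappa>) * (\<integral>\<^sup>+y\<in>{0..?c}. ennreal (\<bar>?G y\<bar> powr p) \<partial>lborel)
      + ennreal (h powr (real n * p) * ?l * (K * 2 ^ Suc k)) * smoothness_integral m p h g"
    using h by (simp add: \<kappa>_def K_def ennreal_mult distrib_left mult.assoc del: power_Suc)
  also have "h powr (real n * p) * ?l * \<kappa> = real ?r * (8 * m * 2 ^ m) powr (1 - p) * h powr (real ?r * p)"
  proof -
    have "4 * 2^m / T = (8 * m * 2 ^ m) / h" using m h by (simp add: T_def)
    then have "\<kappa> = (8 * m * 2 ^ m) powr (1 - p) * h powr (p - 1)"
      using h powr_minus_divide[of h "1 - p"] by (simp only: \<kappa>_def powr_divide) simp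
    moreover have "h powr (real n * p) * h * h powr (p - 1) = h powr (real ?r * p)"
      using h powr_add[of h "real n * p" "p"] powr_mult_base[of h "p - 1"] by (simp add: algebra_simps)
    ultimately show ?thesis by (simp add: mult_ac)
  qed
  also have "h powr (real n * p) * ?l * (K * 2 ^ Suc k)
      = real ?r * 2 powr (p + 1) * (4 * 2 ^ m) powr (1 - p) * 2 ^ Suc k * h powr (real ?r * p - p + 1)"
  proof -
    have "h powr (real n * p) * h = h powr (real ?r * p - p + 1)"
      using h powr_add[of h "real n * p" 1] by (simp add: algebra_simps)
    then show ?thesis by (simp add: K_def mult_ac)
  qed
  finally show ?thesis .
qed

section \<open>Moduli of smoothness and the inequality\<close>

lemma ennpowr_mono: "0 \<le> a \<Longrightarrow> x \<le> y \<Longrightarrow> x ennpowr a \<le> y ennpowr a"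
  by (auto simp: ennpowr_def top_unique less_top intro!: ennreal_leI powr_mono2 enn2real_mono)

lemma ennpowr_inverse: "0 < p \<Longrightarrow> (x ennpowr (1 / p)) ennpowr p = x"
  by (auto simp: ennpowr_def powr_powr less_top)

lemma ennpowr_cmult: "0 < c \<Longrightarrow> (ennreal c * x) ennpowr a = ennreal (c powr a) * x ennpowr a"
  by (auto simp: ennpowr_def ennreal_mult_eq_top_iff enn2real_mult powr_mult ennreal_mult ennreal_mult_top)

lemma ennpowr_add_le:
  assumes a: "0 \<le> a"
  shows "(x + y) ennpowr a \<le> ennreal (2 powr a) * (x ennpowr a + y ennpowr a)"
proof -
  have "x + y \<le> ennreal 2 * max x y"
    by (cases "x \<le> y") (auto simp: max_def mult_2 intro: add_mono)
  then have "(x + y) ennpowr a \<le> (ennreal 2 * max x y) ennpowr a" by (rule ennpowr_mono[OF a])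
  also have "\<dots> = ennreal (2 powr a) * (max x y) ennpowr a" by (rule ennpowr_cmult) simp
  also have "\<dots> \<le> ennreal (2 powr a) * (x ennpowr a + y ennpowr a)"
    by (intro mult_left_mono) (auto simp: max_def)
  finally show ?thesis .
qed

lemma Lp_norm_on_lborel:
  "Lp_norm_on p a b g = (\<integral>\<^sup>+x\<in>{a..b}. ennreal (\<bar>g x\<bar> powr p) \<partial>lborel) ennpowr (1 / p)"
  by (simp add: Lp_norm_on_def nn_integral_completion)

text \<open>The difference at \<open>x\<close> samples \<open>x + \<nu> h\<close>, so the exceptional set is a finite union of translates of a null set. This
  allows Borel representatives to replace derivatives that exist only almost everywhere.\<close>
lemma AE_finite_difference_cong:
  assumes eq: "AE x in lborel. x \<in> {0..1} \<longrightarrow> f x = g x" and h: "0 \<le> h"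
  shows "AE x in lborel. x \<in> {0..1 - real s * h} \<longrightarrow> finite_difference s h f x = finite_difference s h g x"
proof -
  obtain N where "{x \<in> space lborel. \<not> (x \<in> {0..1} \<longrightarrow> f x = g x)} \<subseteq> N"
    "emeasure lborel N = 0" "N \<in> sets lborel"
    using eq by (rule AE_E)
  then have N: "N \<in> null_sets lborel" "\<And>x. x \<notin> N \<Longrightarrow> x \<in> {0..1} \<Longrightarrow> f x = g x"
    by auto
  then have "negligible N" by (simp add: negligible_iff_null_sets null_sets_completionI)
  then have "negligible (\<Union>\<nu>\<in>{..s}. (+) (- (real \<nu> * h)) ` N)"
    by (intro negligible_Union) (simp, blast intro: negligible_translation)
  then have "AE x in lebesgue. x \<notin> (\<Union>\<nu>\<in>{..s}. (+) (- (real \<nu> * h)) ` N)"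
    by (intro AE_not_in) (simp add: negligible_iff_null_sets)
  then have "AE x in lebesgue. x \<in> {0..1 - real s * h} \<longrightarrow> finite_difference s h f x = finite_difference s h g x"
  proof (rule eventually_mono, intro impI)
    fix x assume x: "x \<notin> (\<Union>\<nu>\<in>{..s}. (+) (- (real \<nu> * h)) ` N)" "x \<in> {0..1 - real s * h}"
    have "f (x + real \<nu> * h) = g (x + real \<nu> * h)" if \<nu>: "\<nu> \<le> s" for \<nu>
    proof (rule N(2))
      show "x + real \<nu> * h \<notin> N"
      proof
        assume "x + real \<nu> * h \<in> N"
        then have "- (real \<nu> * h) + (x + real \<nu> * h) \<in> (+) (- (real \<nu> * h)) ` N" by (rule imageI)
        then show False using x(1) \<nu> by auto
      qed
      have "0 \<le> real \<nu> * h" "real \<nu> * h \<le> real s * h" using \<nu> h by (auto intro!: mult_right_mono)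
      then show "x + real \<nu> * h \<in> {0..1}" using x(2) by auto
    qed
    then show "finite_difference s h f x = finite_difference s h g x"
      by (simp add: finite_difference_def)
  qed
  then show ?thesis by (simp add: AE_completion_iff)
qed

lemma Lp_norm_on_finite_difference_cong:
  assumes "AE x in lborel. x \<in> {0..1} \<longrightarrow> f x = g x" "0 \<le> h"
  shows "Lp_norm_on p 0 (1 - real s * h) (finite_difference s h f)
    = Lp_norm_on p 0 (1 - real s * h) (finite_difference s h g)"
  unfolding Lp_norm_on_lborel
  using AE_finite_difference_cong[OF assms, of s]
  by (intro arg_cong[where f = "\<lambda>I. I ennpowr (1 / p)"] nn_integral_cong_AE)
     (auto elim!: eventually_mono simp: indicator_def)

lemma smoothness_integral_le:
  assumes p: "0 < p" and g: "AE x in lborel. x \<in> {0..1} \<longrightarrow> f x = g x" and h: "h \<le> \<delta>"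
  shows "smoothness_integral m p h g
    \<le> (\<integral>\<^sup>+t\<in>{0<..<\<delta>}. modulus_of_smoothness m f t p ennpowr p / ennreal (t powr (2 - p)) \<partial>lebesgue)"
  unfolding smoothness_integral_def nn_integral_completion
proof (intro nn_integral_mono)
  fix t :: real
  let ?N = "\<integral>\<^sup>+z\<in>{0..1 - real m * t}. ennreal (\<bar>finite_difference m t g z\<bar> powr p) \<partial>lborel"
  have "ennreal (t powr (p - 2)) * ?N \<le> modulus_of_smoothness m f t p ennpowr p / ennreal (t powr (2 - p))"
    if t: "0 < t"
  proof -
    have "?N = Lp_norm_on p 0 (1 - real m * t) (finite_difference m t f) ennpowr p"
      using Lp_norm_on_finite_difference_cong[OF g, of t p m] t p
      by (simp add: Lp_norm_on_lborel[of p _ _ "finite_difference m t g"] ennpowr_inverse)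
    also have "\<dots> \<le> modulus_of_smoothness m f t p ennpowr p"
      unfolding modulus_of_smoothness_def using t p by (intro ennpowr_mono SUP_upper) auto
    finally have "?N * ennreal (t powr (p - 2)) \<le> modulus_of_smoothness m f t p ennpowr p * ennreal (t powr (p - 2))"
      by (intro mult_right_mono) auto
    moreover have "ennreal (t powr (p - 2)) = inverse (ennreal (t powr (2 - p)))"
      using t powr_minus[of t "2 - p"] by (simp add: inverse_ennreal)
    ultimately show ?thesis by (simp only: divide_ennreal_def mult.commute[of _ ?N])
  qed
  then show "ennreal (t powr (p - 2)) * ?N * indicator {0<..<h} t
      \<le> modulus_of_smoothness m f t p ennpowr p / ennreal (t powr (2 - p)) * indicator {0<..<\<delta>} t"
    using h by (auto simp: indicator_def)
qed

theorem theorem3p4: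
  fixes p :: real and r k m :: nat
  assumes "0 < p" and "p < 1"
    and "1 \<le> r" and "1 \<le> k" and "1 \<le> m"
  shows "\<exists>C::real. 0 < C \<and>
    (\<forall>(f :: real \<Rightarrow> real) (\<delta>::real). deriv_AC (r - 1) f \<longrightarrow> 0 < \<delta> \<longrightarrow>
      modulus_of_smoothness (r + k) f \<delta> p
        \<le> ennreal (C * \<delta> ^ r) * modulus_of_smoothness k (nth_deriv_within {0..1} r f) \<delta> p
          + ennreal (C * \<delta> powr (real r + 1 / p - 1))
            * (\<integral>\<^sup>+t\<in>{0<..<\<delta>}.
                 modulus_of_smoothness m (nth_deriv_within {0..1} r f) t p ennpowr p
                   / ennreal (t powr (2 - p)) \<partial>lebesgue) ennpowr (1 / p))"
proof -
  obtain n where r: "r = Suc n" using \<open>1 \<le> r\<close> by (cases r) auto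
  define a where "a = real r * (8 * m * 2 ^ m) powr (1 - p)"
  define b where "b = real r * 2 powr (p + 1) * (4 * 2 ^ m) powr (1 - p) * 2 ^ Suc k"
  have a: "0 < a" and b: "0 < b" using \<open>1 \<le> m\<close> r by (auto simp: a_def b_def)
  define C where "C = 2 powr (1 / p) * max (a powr (1 / p)) (b powr (1 / p))"
  have C: "0 < C" using a by (auto simp: C_def less_max_iff_disj)
  have main: "modulus_of_smoothness (r + k) f \<delta> p
        \<le> ennreal (C * \<delta> ^ r) * modulus_of_smoothness k (nth_deriv_within {0..1} r f) \<delta> p
          + ennreal (C * \<delta> powr (real r + 1 / p - 1))
            * (\<integral>\<^sup>+t\<in>{0<..<\<delta>}.
                 modulus_of_smoothness m (nth_deriv_within {0..1} r f) t p ennpowr p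
                   / ennreal (t powr (2 - p)) \<partial>lebesgue) ennpowr (1 / p)"
    (is "_ \<le> ennreal (C * \<delta> ^ r) * ?\<omega> + ennreal (C * \<delta> powr ?e) * ?B ennpowr (1 / p)")
    if f: "deriv_AC (r - 1) f" and \<delta>: "0 < \<delta>" for f :: "real \<Rightarrow> real" and \<delta> :: real
    unfolding modulus_of_smoothness_def[of "r + k"]
  proof (rule SUP_least)
    fix h assume h: "h \<in> {0<..\<delta>}"
    let ?g = "nth_deriv_within {0..1} r f"
    let ?R = "ennreal (C * \<delta> ^ r) * ?\<omega> + ennreal (C * \<delta> powr ?e) * ?B ennpowr (1 / p)"
    have "deriv_AC n f" using f r by simp
    then obtain \<phi> where \<phi>: "\<phi> \<in> borel_measurable borel" "AE x in lborel. x \<in> {0..1} \<longrightarrow> ?g x = \<phi> x"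
      "primitive_on_unit \<phi> (nth_deriv_within {0..1} n f)"
      "\<And>j. j < n \<Longrightarrow> primitive_on_unit (nth_deriv_within {0..1} (Suc j) f) (nth_deriv_within {0..1} j f)"
      unfolding r by (rule deriv_AC_primitive_chain) blast
    define D where "D j = (if j \<le> n then nth_deriv_within {0..1} j f else \<phi>)" for j
    have D: "primitive_on_unit (D (Suc j)) (D j)" if "j \<le> n" for j
      using \<phi>(3,4) that by (cases "j = n") (auto simp: D_def)
    have D0: "D 0 = f" and Dr: "D (Suc n) = \<phi>" by (auto simp: D_def)
    let ?X = "\<integral>\<^sup>+y\<in>{0..1 - real k * h}. ennreal (\<bar>finite_difference k h \<phi> y\<bar> powr p) \<partial>lborel"
    show "Lp_norm_on p 0 (1 - real (r + k) * h) (finite_difference (r + k) h f) \<le> ?R"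
    proof (cases "real (k + Suc n) * h \<le> 1")
      case False
      \<comment> \<open>Steps this large leave an empty interval, on which the norm is zero.\<close>
      then show ?thesis
        using assms by (simp add: Lp_norm_on_lborel r add.commute ennpowr_def)
    next
      case True
      have X: "?X ennpowr (1 / p) \<le> ?\<omega>"
      proof -
        have "?X ennpowr (1 / p) = Lp_norm_on p 0 (1 - real k * h) (finite_difference k h ?g)"
          using Lp_norm_on_finite_difference_cong[OF \<phi>(2), of h p k] h by (simp add: Lp_norm_on_lborel)
        also have "\<dots> \<le> ?\<omega>" unfolding modulus_of_smoothness_def using h by (intro SUP_upper) auto
        finally show ?thesis .
      qed
      have "(\<integral>\<^sup>+x\<in>{0..1 - real (k + Suc n) * h}. ennreal (\<bar>finite_difference (k + Suc n) h f x\<bar> powr p) \<partial>lborel)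
          \<le> ennreal (a * h powr (real r * p)) * ?X + ennreal (b * h powr (real r * p - p + 1)) * smoothness_integral m p h \<phi>"
        using Lp_power_difference_le[of p m D n h k] assms \<phi>(1) D h True
        unfolding D0 Dr a_def b_def r by simp
      also have "\<dots> \<le> ennreal (a * \<delta> powr (real r * p)) * ?X + ennreal (b * \<delta> powr (real r * p - p + 1)) * ?B"
      proof (intro add_mono mult_mono ennreal_leI powr_mono2)
        show "smoothness_integral m p h \<phi> \<le> ?B"
          using smoothness_integral_le[OF _ \<phi>(2)] assms h by auto
        have "p \<le> real r * p" using assms by simp
        then show "0 \<le> real r * p - p + 1" by simp
      qed (use a b h assms in auto)
      finally have "Lp_norm_on p 0 (1 - real (r + k) * h) (finite_difference (r + k) h f)
          \<le> (ennreal (a * \<delta> powr (real r * p)) * ?X + ennreal (b * \<delta> powr (real r * p - p + 1)) * ?B) ennpowr (1 / p)"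
        using assms unfolding Lp_norm_on_lborel r by (simp add: add.commute ennpowr_mono)
      also have "\<dots> \<le> ennreal (2 powr (1 / p)) * ((ennreal (a * \<delta> powr (real r * p)) * ?X) ennpowr (1 / p)
          + (ennreal (b * \<delta> powr (real r * p - p + 1)) * ?B) ennpowr (1 / p))"
        using assms by (intro ennpowr_add_le) simp
      also have "\<dots> = ennreal (2 powr (1 / p)) * (ennreal ((a * \<delta> powr (real r * p)) powr (1 / p)) * ?X ennpowr (1 / p)
          + ennreal ((b * \<delta> powr (real r * p - p + 1)) powr (1 / p)) * ?B ennpowr (1 / p))"
        using a b \<delta> by (simp add: ennpowr_cmult)
      also have "(a * \<delta> powr (real r * p)) powr (1 / p) = a powr (1 / p) * \<delta> ^ r"
        using a \<delta> assms by (simp add: powr_mult powr_powr powr_realpow)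
      also have "(b * \<delta> powr (real r * p - p + 1)) powr (1 / p) = b powr (1 / p) * \<delta> powr ?e"
      proof -
        have "(real r * p - p + 1) * (1 / p) = ?e" using assms by (simp add: field_simps)
        then show ?thesis using b \<delta> by (simp only: powr_mult powr_powr)
      qed
      also have "ennreal (2 powr (1 / p)) * (ennreal (a powr (1 / p) * \<delta> ^ r) * ?X ennpowr (1 / p)
            + ennreal (b powr (1 / p) * \<delta> powr ?e) * ?B ennpowr (1 / p))
          = ennreal (2 powr (1 / p) * a powr (1 / p) * \<delta> ^ r) * ?X ennpowr (1 / p)
            + ennreal (2 powr (1 / p) * b powr (1 / p) * \<delta> powr ?e) * ?B ennpowr (1 / p)"
        using \<delta> by (simp add: distrib_left ennreal_mult mult.assoc)
      also have "\<dots> \<le> ?R"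
        using X \<delta> less_imp_le[OF C] unfolding C_def by (intro add_mono mult_mono ennreal_leI) auto
      finally show ?thesis .
    qed
  qed
  then show ?thesis using C by blast
qed

end
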